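(* Let $\{r_i\}_{i=1}^\infty$ be the sequence of all rational numbers in lowest terms in $(0,1)$, ordered first by increasing denominator and then by increasing numerator, and let $\mathbb{P}$ be the set of primes. Let $R$ be one of the following subsequences of $\{r_i\}$ (numerators and denominators taken in lowest terms): (1) those whose numerator is in $\mathbb{N}$ and whose denominator is in $\mathbb{P}$; (2) those whose numerator is in $\mathbb{P}$ and whose denominator is in $\mathbb{N}$; (3) those whose numerator and denominator are both in $\mathbb{P}$. If the indices of the $r_i\in R$ are, in increasing order, $i_1<i_2<i_3<\cdots$, then the number whose continued fraction expansion is obtained by concatenating, in order, the finite continued fraction expansions of $r_{i_1},r_{i_2},r_{i_3},\dots$ is CF-normal.
   Context: Every $x\in[0,1)$ has a continued fraction expansion $x=\langle a_1,a_2,\dots\rangle$ with $a_i\in\mathbb{N}$; for rationals, the longer of the two finite expansions (the one ending in the digit $1$) is used. The Gauss measure is $\mu(A)=\frac{1}{\log 2}\int_A \frac{dx}{1+x}$; for a finite string $s=[d_1,\dots,d_k]$ of positive integers, $C_s=\{x\in[0,1):a_i(x)=d_i,\ 1\le i\le k\}$; $A_s(N;x)$ is the number of positions $1\le i\le N$ at which $s$ starts in the continued fraction expansion of $x$. A number is CF-normal if $A_s(N;x)/N\to\mu(C_s)$ for every finite string $s$. *)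

theory Defs
  imports "HOL-Analysis.Analysis" "HOL-Computational_Algebra.Primes"
begin

definition gauss_map :: "real \<Rightarrow> real" where
  "gauss_map x = (if x = 0 then 0 else frac (1 / x))"

text \<open>The n-th continued fraction digit a_n(x) (n \<ge> 1) of x in [0,1).
  Value 0 means "no digit at this position" (finite expansion has ended).
  For rationals the longer finite expansion (ending in the digit 1) is used:
  the last Euclidean digit a is replaced by a-1 followed by a 1.\<close>
definition cf_digit :: "real \<Rightarrow> nat \<Rightarrow> nat" where
  "cf_digit x n =
     (if n = 0 then 0 else
      (let y = (gauss_map ^^ (n - 1)) x in
       if y \<noteq> 0 then
         (if gauss_map y = 0 then nat \<lfloor>1 / y\<rfloor> - 1 else nat \<lfloor>1 / y\<rfloor>)
       else if n \<ge> 2 \<and> (gauss_map ^^ (n - 2)) x \<noteq> 0 then 1 else 0))"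

definition cylinder :: "nat list \<Rightarrow> real set" where
  "cylinder s = {x. 0 \<le> x \<and> x < 1 \<and> (\<forall>i < length s. cf_digit x (i + 1) = s ! i)}"

definition gauss_measure :: "real set \<Rightarrow> real" where
  "gauss_measure A = (1 / ln 2) * (LINT x:A|lborel. 1 / (1 + x))"

definition occ_count :: "nat list \<Rightarrow> nat \<Rightarrow> real \<Rightarrow> nat" where
  "occ_count s N x = card {i \<in> {1..N}. \<forall>j < length s. cf_digit x (i + j) = s ! j}"

definition CF_normal :: "real \<Rightarrow> bool" where
  "CF_normal x \<longleftrightarrow> (\<forall>s. s \<noteq> [] \<and> (\<forall>d \<in> set s. d > 0) \<longrightarrow>
      (\<lambda>N. real (occ_count s N x) / real N) \<longlonglongrightarrow> gauss_measure (cylinder s))"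

fun cf_euclid :: "nat \<Rightarrow> nat \<Rightarrow> nat list" where
  "cf_euclid p q = (if p = 0 then [] else if q mod p = 0 then [q div p]
                    else q div p # cf_euclid (q mod p) p)"

definition cf_long :: "nat \<Rightarrow> nat \<Rightarrow> nat list" where
  "cf_long p q = (let l = cf_euclid p q in butlast l @ [last l - 1, 1])"

definition sel_with_denom :: "(nat \<Rightarrow> nat \<Rightarrow> bool) \<Rightarrow> nat \<Rightarrow> (nat \<times> nat) list" where
  "sel_with_denom sel q = [(p, q). p \<leftarrow> [1..<q], coprime p q \<and> sel p q]"

definition concat_word :: "(nat \<Rightarrow> nat \<Rightarrow> bool) \<Rightarrow> nat \<Rightarrow> nat list" where
  "concat_word sel Q =
     concat (map (\<lambda>(p, q). cf_long p q) (concat (map (sel_with_denom sel) [2..<Q])))"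

end

theory Submission
  imports Defs "HOL-Probability.Probability" "HOL-Real_Asymp.Real_Asymp"
begin

text \<open>
  Conditionally on a prefix of the expansion with consecutive denominators \<open>q', q\<close>, the next digit of a
  Lebesgue random number is \<open>k\<close> with probability \<open>(1+t) / ((k+t) (k+t+1))\<close>, where \<open>t = q'/q\<close>, and then
  \<open>t\<close> becomes \<open>1/(k+t)\<close>. The operator of this Markov chain contracts Lipschitz seminorms and preserves
  the Gauss measure, so from every starting point \<open>t\<close> the expected frequency of a string \<open>s\<close> tends
  uniformly to \<open>\<mu>(C\<^sub>s)\<close>; exponential moments over long blocks then show that words of length \<open>n\<close> with a
  wrong frequency of \<open>s\<close> have total probability \<open>O(exp(-\<delta>n))\<close>.

  A word with denominator \<open>q\<close> has probability at least \<open>1/(2q\<^sup>2)\<close>, hence only \<open>O(Q\<^bsup>2-\<eta>\<^esup>)\<close> rationals with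
  denominator at most \<open>Q\<close> have an expansion that is shorter than \<open>c log Q\<close> or has a wrong frequency
  of \<open>s\<close>. By Chebyshev's bound the pairs of primes alone provide more than \<open>Q\<^bsup>2-\<eta>/2\<^esup>\<close> selected rationals, so
  the exceptional ones are negligible in all three cases.
\<close>

section \<open>The Markov chain of digits\<close>

text \<open>The obstacle is sparsity: in the third case only about Q^2 / (log Q)^2 rationals with
  denominator at most Q are selected, so the exceptional ones must be fewer than Q^2 by a power of
  Q. A deviation bound O(exp(-\<delta>n)) gives such a power only for lengths n >= c log Q. Shorter
  expansions are counted separately. Digit weights decay like k^-2, so the mean digit is infinite
  but the mean of sqrt k is finite, and the expected square root of the denominator of a word of
  length n is at most B^n. Weighting words by this root bounds their number by a multiple of Q^(3/2)
  B^n, a power saving once c is small compared with 1 / log B. Independence of digits is replaced by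
  uniformity in the state t. In a block of any length the expected number of occurrences of s
  differs from its ideal value by a bounded amount, so long blocks have small relative bias, and the
  exponential moments of consecutive blocks multiply.\<close>

definition gauss_prob :: "real \<Rightarrow> real \<Rightarrow> real" where
  "gauss_prob t k = (1 + t) / ((k + t) * (k + t + 1))"

lemma gauss_prob_nonneg: "0 \<le> t \<Longrightarrow> 0 \<le> k \<Longrightarrow> 0 \<le> gauss_prob t k"
  by (simp add: gauss_prob_def)

lemma gauss_prob_telescope:
  assumes "0 \<le> t"
  shows "gauss_prob t (real (Suc k)) = (1 + t) / (real (Suc k) + t) - (1 + t) / (real (Suc (Suc k)) + t)"
  using assms by (simp add: gauss_prob_def field_simps)

lemma gauss_prob_sums:
  assumes "0 \<le> t"
  shows "(\<lambda>k. gauss_prob t (real (Suc k))) sums 1"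
proof -
  have "(\<lambda>k. (1 + t) / (real (Suc k) + t)) \<longlonglongrightarrow> 0" by real_asymp
  from telescope_sums'[OF this] assms show ?thesis
    by (subst gauss_prob_telescope[OF assms]) simp
qed

text \<open>The shift by \<open>Suc\<close> makes every digit positive whatever \<open>t\<close> is,
  even where the weights are no distribution and \<open>embed_pmf\<close> has no specified
  value.\<close>

definition digit_pmf :: "real \<Rightarrow> nat pmf" where
  "digit_pmf t = map_pmf Suc (embed_pmf (\<lambda>k. gauss_prob t (real (Suc k))))"

lemma pmf_embed_gauss_prob:
  assumes "0 \<le> t"
  shows "pmf (embed_pmf (\<lambda>k. gauss_prob t (real (Suc k)))) k = gauss_prob t (real (Suc k))"
proof (rule pmf_embed_pmf)
  show "(\<integral>\<^sup>+ x. ennreal (gauss_prob t (real (Suc x))) \<partial>count_space UNIV) = 1"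
    using gauss_prob_sums[OF assms] assms
    by (subst nn_integral_count_space_nat, subst suminf_ennreal2)
       (auto simp: sums_iff intro!: gauss_prob_nonneg)
qed (use assms in \<open>auto intro!: gauss_prob_nonneg\<close>)

lemma pmf_digit_pmf:
  assumes "0 \<le> t" "0 < k"
  shows "pmf (digit_pmf t) k = gauss_prob t (real k)"
proof -
  obtain j where "k = Suc j" using assms(2) by (cases k) auto
  then show ?thesis using assms
    by (simp add: digit_pmf_def pmf_map_inj' pmf_embed_gauss_prob del: of_nat_Suc)
qed

lemma set_digit_pmf: "k \<in> set_pmf (digit_pmf t) \<Longrightarrow> 0 < k"
  by (auto simp: digit_pmf_def)

lemma nn_integral_digit_pmf:
  assumes "0 \<le> t"
  shows "(\<integral>\<^sup>+k. f k \<partial>digit_pmf t) = (\<Sum>k. ennreal (gauss_prob t (real (Suc k))) * f (Suc k))"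
  unfolding digit_pmf_def nn_integral_map_pmf
  by (simp add: nn_integral_measure_pmf pmf_embed_gauss_prob[OF assms]
      nn_integral_count_space_nat del: of_nat_Suc)

text \<open>The bound is asked of positive \<open>k\<close> only: in the intended
  \<open>g (1 / (k + t))\<close> the argument may leave the unit interval at
  \<open>k = 0\<close>.\<close>

lemma expectation_digit_pmf_sums:
  fixes f :: "nat \<Rightarrow> real"
  assumes "0 \<le> t" and B: "\<And>k. 0 < k \<Longrightarrow> \<bar>f k\<bar> \<le> B"
  shows "(\<lambda>k. gauss_prob t (real (Suc k)) * f (Suc k)) sums measure_pmf.expectation (digit_pmf t) f"
proof -
  let ?p = "embed_pmf (\<lambda>k. gauss_prob t (real (Suc k)))"
  have int: "integrable (count_space UNIV) (\<lambda>k. gauss_prob t (real (Suc k)) * f (Suc k))"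
    unfolding integrable_count_space_nat_iff
  proof (rule summable_comparison_test')
    show "summable (\<lambda>k. gauss_prob t (real (Suc k)) * B)"
      using gauss_prob_sums[OF assms(1)] by (intro summable_mult2) (simp add: sums_iff)
    show "norm (norm (gauss_prob t (real (Suc k)) * f (Suc k))) \<le> gauss_prob t (real (Suc k)) * B" for k
      using B[of "Suc k"] gauss_prob_nonneg[OF assms(1), of "real (Suc k)"]
      by (auto simp: abs_mult intro!: mult_left_mono)
  qed
  have "measure_pmf.expectation (digit_pmf t) f
      = (\<integral>k. gauss_prob t (real (Suc k)) * f (Suc k) \<partial>count_space UNIV)"
    unfolding digit_pmf_def integral_map_pmf
    by (subst measure_pmf_eq_density, subst integral_density)
       (auto simp: pmf_embed_gauss_prob[OF assms(1)] simp del: of_nat_Suc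
          intro!: gauss_prob_nonneg assms)
  then show ?thesis using sums_integral_count_space_nat[OF int] by simp
qed

text \<open>This is the Gauss-Kuzmin operator conjugated by the invariant density 1 / (1 + t), so
  that it fixes constants.\<close>

definition gauss_op :: "(real \<Rightarrow> real) \<Rightarrow> real \<Rightarrow> real" where
  "gauss_op g t = measure_pmf.expectation (digit_pmf t) (\<lambda>k. g (1 / (real k + t)))"

lemma gauss_branch_mem:
  "0 < (k::nat) \<Longrightarrow> 0 \<le> t \<Longrightarrow> t \<le> 1 \<Longrightarrow> 1 / (real k + t) \<in> {0..1::real}"
  by (simp add: field_simps)

lemma gauss_op_sums:
  assumes t: "t \<in> {0..1}" and B: "\<And>x. x \<in> {0..1} \<Longrightarrow> \<bar>g x\<bar> \<le> B"
  shows "(\<lambda>k. gauss_prob t (real (Suc k)) * g (1 / (real (Suc k) + t))) sums gauss_op g t"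
  unfolding gauss_op_def
  using t by (intro expectation_digit_pmf_sums[where B=B] B gauss_branch_mem) auto

text \<open>Comparing the chain started in \<open>x\<close> and in \<open>y\<close>: the images of equal digits are closer by a
  factor 5/8, and the change of the digit distribution is estimated by Abel summation.\<close>

lemma gauss_op_contraction_aux:
  assumes x: "x \<in> {0..1}" and y: "y \<in> {0..1}" and xy: "x \<le> y"
    and L: "\<And>u v. u \<in> {0..1} \<Longrightarrow> v \<in> {0..1} \<Longrightarrow> \<bar>g u - g v\<bar> \<le> L * \<bar>u - v\<bar>"
    and B: "\<And>u. u \<in> {0..1} \<Longrightarrow> \<bar>g u\<bar> \<le> B"
  shows "\<bar>gauss_op g x - gauss_op g y\<bar> \<le> 7 / 8 * L * \<bar>x - y\<bar>"
proof -
  have L0: "0 \<le> L" using L[of 0 1] by simp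
  define gx where "gx k = g (1 / (real (Suc k) + x))" for k
  define gy where "gy k = g (1 / (real (Suc k) + y))" for k
  define px where "px k = gauss_prob x (real (Suc k))" for k
  define py where "py k = gauss_prob y (real (Suc k))" for k
  \<comment> \<open>\<open>S t k\<close> is the probability that the first digit exceeds
    \<open>k\<close>, so \<open>D\<close> compares two tail distributions; \<open>D 0 = 0\<close>
    because both tails are then 1.\<close>
  define S where "S t k = (1 + t) / (real (Suc k) + t)" for t :: real and k
  define D where "D k = S x k - S y k" for k
  have pS: "px k - py k = D k - D (Suc k)" for k
    unfolding px_def py_def D_def S_def using x y
    by (simp add: gauss_prob_telescope del: of_nat_Suc)
  have sx: "(\<lambda>k. px k * gx k) sums gauss_op g x" and sy: "(\<lambda>k. py k * gy k) sums gauss_op g y"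
    unfolding px_def py_def gx_def gy_def using gauss_op_sums x y B by blast+
  have px1: "px sums 1" unfolding px_def using gauss_prob_sums x by auto
  have gxyk: "\<bar>gx k - gy k\<bar> \<le> L * \<bar>x - y\<bar> / (real (Suc k) + x)^2" for k
  proof -
    have "\<bar>gx k - gy k\<bar> \<le> L * \<bar>1 / (real (Suc k) + x) - 1 / (real (Suc k) + y)\<bar>"
      unfolding gx_def gy_def using x y by (intro L gauss_branch_mem) auto
    also have "\<bar>1 / (real (Suc k) + x) - 1 / (real (Suc k) + y)\<bar>
        = \<bar>x - y\<bar> / ((real (Suc k) + x) * (real (Suc k) + y))"
      using x y xy by (simp add: field_simps)
    also have "\<dots> \<le> \<bar>x - y\<bar> / (real (Suc k) + x)^2"
      unfolding power2_eq_square using x y xy by (intro divide_left_mono mult_left_mono) auto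
    finally show ?thesis using L0 by (simp add: mult_left_mono)
  qed
  have gyk: "\<bar>gy (Suc k) - gy k\<bar> \<le> L / ((real (Suc k) + y) * (real (Suc (Suc k)) + y))" for k
  proof -
    have "\<bar>gy (Suc k) - gy k\<bar> \<le> L * \<bar>1 / (real (Suc (Suc k)) + y) - 1 / (real (Suc k) + y)\<bar>"
      unfolding gy_def using y by (intro L gauss_branch_mem) auto
    also have "\<bar>1 / (real (Suc (Suc k)) + y) - 1 / (real (Suc k) + y)\<bar>
        = 1 / ((real (Suc k) + y) * (real (Suc (Suc k)) + y))"
      using y by (simp add: field_simps)
    finally show ?thesis by simp
  qed
  have px0: "0 \<le> px k" for k unfolding px_def using x by (auto intro!: gauss_prob_nonneg)
  \<comment> \<open>Digit 1 has probability p <= 1/2 and a branch with Lipschitz constant at most 1;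
    the branches of larger digits have constant at most 1/4. Hence p + (1 - p) / 4 <= 5/8.\<close>
  have first: "(\<Sum>k<n. px k * \<bar>gx k - gy k\<bar>) \<le> 5/8 * L * \<bar>x - y\<bar>" for n
  proof -
    define c where "c = L * \<bar>x - y\<bar>"
    have c0: "0 \<le> c" using L0 by (simp add: c_def)
    have bd: "px k * \<bar>gx k - gy k\<bar> \<le> c * (px k / (real (Suc k) + x)^2)" for k
      using mult_left_mono[OF gxyk[of k] px0[of k]] by (simp add: c_def mult_ac)
    have "(\<Sum>k<n. px k * \<bar>gx k - gy k\<bar>) \<le> (\<Sum>k<Suc n. px k * \<bar>gx k - gy k\<bar>)"
      using px0 by (intro sum_mono2) auto
    also have "\<dots> \<le> (\<Sum>k<Suc n. c * (px k / (real (Suc k) + x)^2))"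
      by (intro sum_mono bd)
    also have "\<dots> = c * (px 0 / (1 + x)^2 + (\<Sum>k<n. px (Suc k) / (real (Suc (Suc k)) + x)^2))"
      by (subst sum.lessThan_Suc_shift) (simp add: sum_distrib_left distrib_left)
    also have "\<dots> \<le> c * (px 0 / (1 + x)^2 + (\<Sum>k<n. px (Suc k) / 4))"
    proof (intro mult_left_mono add_left_mono sum_mono c0 divide_left_mono px0)
      fix k
      have "2 ^ 2 \<le> (real (Suc (Suc k)) + x)^2" using x by (intro power_mono) auto
      then show "4 \<le> (real (Suc (Suc k)) + x)^2" by simp
      show "0 < (real (Suc (Suc k)) + x)\<^sup>2 * 4" using x by simp
    qed
    also have "\<dots> \<le> c * (px 0 / (1 + x)^2 + (1 - px 0) / 4)"
    proof (intro mult_left_mono add_left_mono c0)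
      have "(\<Sum>k<Suc n. px k) \<le> 1" using sum_le_suminf[of px "{..<Suc n}"] px1 px0 by (simp add: sums_iff)
      then show "(\<Sum>k<n. px (Suc k) / 4) \<le> (1 - px 0) / 4"
        by (subst (asm) sum.lessThan_Suc_shift) (simp add: sum_divide_distrib[symmetric])
    qed
    also have "\<dots> \<le> c * (5/8)"
    proof (intro mult_left_mono c0)
      have *: "u \<le> v / 1 \<Longrightarrow> v \<le> 1/2 \<Longrightarrow> u + (1 - v) / 4 \<le> 5/8" for u v :: real
        by (simp add: field_simps)
      have "0 < x * x + (2 + x * 3)" using x by (auto intro: add_nonneg_pos[of "x * x" "2 + x * 3"])
      then have p0: "px 0 = 1 / (2 + x)" unfolding px_def gauss_prob_def using x by (simp add: field_simps)
      have "px 0 / (1 + x)^2 \<le> px 0 / 1"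
        using x px0[of 0] by (intro divide_left_mono) auto
      moreover have "px 0 \<le> 1/2" unfolding p0 using x by (simp add: field_simps)
      ultimately show "px 0 / (1 + x)^2 + (1 - px 0) / 4 \<le> 5/8"
        using * by fastforce
    qed
    finally show ?thesis by (simp add: c_def)
  qed
  have Dk: "\<bar>D k\<bar> \<le> \<bar>x - y\<bar> * (real k / ((real (Suc k) + x) * (real (Suc k) + y)))" for k
  proof -
    have "D k = (x - y) * (real k / ((real (Suc k) + x) * (real (Suc k) + y)))"
      unfolding D_def S_def using x y by (simp add: divide_simps) (simp add: algebra_simps)
    then show ?thesis using x y by (simp add: abs_mult)
  qed
  have abel: "(\<Sum>k<n. (px k - py k) * gy k) = (\<Sum>k<n. D (Suc k) * (gy (Suc k) - gy k)) - D n * gy n" for n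
  proof (induction n)
    case 0
    show ?case using x y by (simp add: D_def S_def)
  next
    case (Suc n)
    then show ?case by (simp add: pS algebra_simps)
  qed
  \<comment> \<open>After Abel summation the summands are at most L |x - y| / ((k+1)(k+2)(k+3)), and
    these reciprocals sum to 1/4; with 5/8 this makes the rate 7/8. The boundary term stays until
    the limit, where \<open>D n\<close> tends to 0.\<close>
  have second: "\<bar>\<Sum>k<n. (px k - py k) * gy k\<bar> \<le> L * \<bar>x - y\<bar> / 4 + \<bar>D n\<bar> * B" for n
  proof -
    have tele: "(\<Sum>k<n. 1 / (real (Suc k) * real (Suc (Suc k)) * real (Suc (Suc (Suc k)))))
       = 1/4 - 1 / (2 * real (Suc n) * real (Suc (Suc n)))" for n
    proof (induction n)
      case (Suc n)
      have "1/4 - 1 / (2 * real (Suc n) * real (Suc (Suc n))) + 1 / (real (Suc n) * real (Suc (Suc n)) * real (Suc (Suc (Suc n))))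
          = 1/4 - 1 / (2 * real (Suc (Suc n)) * real (Suc (Suc (Suc n))))"
        by (simp add: divide_simps) (simp add: algebra_simps)
      then show ?case by (simp only: sum.lessThan_Suc Suc)
    qed simp
    have t: "\<bar>D (Suc k) * (gy (Suc k) - gy k)\<bar>
       \<le> L * \<bar>x - y\<bar> * (1 / (real (Suc k) * real (Suc (Suc k)) * real (Suc (Suc (Suc k)))))" for k
    proof -
      have "\<bar>D (Suc k) * (gy (Suc k) - gy k)\<bar>
          \<le> (\<bar>x - y\<bar> * (real (Suc k) / ((real (Suc (Suc k)) + x) * (real (Suc (Suc k)) + y)))) *
            (L / ((real (Suc k) + y) * (real (Suc (Suc k)) + y)))"
        unfolding abs_mult using x y by (intro mult_mono Dk gyk) auto
      also have "\<dots> = L * \<bar>x - y\<bar> * ((real (Suc k) / (real (Suc k) + y)) *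
          (1 / ((real (Suc (Suc k)) + x) * (real (Suc (Suc k)) + y) * (real (Suc (Suc k)) + y))))"
        by (simp add: mult_ac)
      also have "\<dots> \<le> L * \<bar>x - y\<bar> * (1 * (1 / (real (Suc k) * real (Suc (Suc k)) * real (Suc (Suc (Suc k))))))"
      proof -
        have "real (Suc k) * real (Suc (Suc k)) * real (Suc (Suc (Suc k)))
            \<le> real (Suc (Suc k)) * real (Suc (Suc k)) * real (Suc (Suc k))"
          by (simp add: algebra_simps)
        also have "\<dots> \<le> (real (Suc (Suc k)) + x) * (real (Suc (Suc k)) + y) * (real (Suc (Suc k)) + y)"
          using x y by (intro mult_mono) auto
        finally have "1 / ((real (Suc (Suc k)) + x) * (real (Suc (Suc k)) + y) * (real (Suc (Suc k)) + y))
            \<le> 1 / (real (Suc k) * real (Suc (Suc k)) * real (Suc (Suc (Suc k))))"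
          using x y by (intro divide_left_mono) auto
        then show ?thesis using x y L0 by (intro mult_left_mono mult_mono) (auto simp del: of_nat_Suc)
      qed
      finally show ?thesis by simp
    qed
    have "\<bar>\<Sum>k<n. D (Suc k) * (gy (Suc k) - gy k)\<bar>
        \<le> (\<Sum>k<n. L * \<bar>x - y\<bar> * (1 / (real (Suc k) * real (Suc (Suc k)) * real (Suc (Suc (Suc k))))))"
      by (intro order_trans[OF sum_abs] sum_mono t)
    also have "\<dots> = L * \<bar>x - y\<bar> * (1/4 - 1 / (2 * real (Suc n) * real (Suc (Suc n))))"
      by (subst sum_distrib_left[symmetric], subst tele) simp
    also have "\<dots> \<le> L * \<bar>x - y\<bar> * (1/4)" using L0 by (intro mult_left_mono) auto
    finally have "\<bar>\<Sum>k<n. D (Suc k) * (gy (Suc k) - gy k)\<bar> \<le> L * \<bar>x - y\<bar> / 4" by simp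
    moreover have "\<bar>D n * gy n\<bar> \<le> \<bar>D n\<bar> * B"
      unfolding abs_mult gy_def using y by (intro mult_left_mono B gauss_branch_mem) auto
    ultimately show ?thesis unfolding abel by linarith
  qed
  have "(\<lambda>n. \<bar>\<Sum>k<n. px k * gx k - py k * gy k\<bar>) \<longlonglongrightarrow> \<bar>gauss_op g x - gauss_op g y\<bar>"
    using sums_diff[OF sx sy] unfolding sums_def by (rule tendsto_rabs)
  moreover have "(\<lambda>n. 7/8 * L * \<bar>x - y\<bar> + \<bar>D n\<bar> * B) \<longlonglongrightarrow> 7/8 * L * \<bar>x - y\<bar> + \<bar>0\<bar> * B"
    unfolding D_def S_def by (intro tendsto_intros tendsto_rabs; real_asymp)
  moreover have "\<bar>\<Sum>k<n. px k * gx k - py k * gy k\<bar> \<le> 7/8 * L * \<bar>x - y\<bar> + \<bar>D n\<bar> * B" for n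
  proof -
    have "(\<Sum>k<n. px k * gx k - py k * gy k)
       = (\<Sum>k<n. px k * (gx k - gy k)) + (\<Sum>k<n. (px k - py k) * gy k)"
      by (subst sum.distrib[symmetric]) (simp add: algebra_simps)
    moreover have "\<bar>\<Sum>k<n. px k * (gx k - gy k)\<bar> \<le> (\<Sum>k<n. px k * \<bar>gx k - gy k\<bar>)"
      using px0 by (intro order_trans[OF sum_abs]) (simp add: abs_mult)
    ultimately show ?thesis using first[of n] second[of n] by linarith
  qed
  ultimately have "\<bar>gauss_op g x - gauss_op g y\<bar> \<le> 7/8 * L * \<bar>x - y\<bar> + \<bar>0\<bar> * B"
    by (intro LIMSEQ_le) auto
  then show ?thesis by simp
qed

lemma gauss_op_contraction:
  assumes x: "x \<in> {0..1}" and y: "y \<in> {0..1}"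
    and L: "\<And>u v. u \<in> {0..1} \<Longrightarrow> v \<in> {0..1} \<Longrightarrow> \<bar>g u - g v\<bar> \<le> L * \<bar>u - v\<bar>"
  shows "\<bar>gauss_op g x - gauss_op g y\<bar> \<le> 7 / 8 * L * \<bar>x - y\<bar>"
proof -
  have L0: "0 \<le> L" using L[of 0 1] by simp
  have B: "\<bar>g u\<bar> \<le> \<bar>g 0\<bar> + L" if "u \<in> {0..1}" for u
  proof -
    have "L * \<bar>u - 0\<bar> \<le> L * 1" using that L0 by (intro mult_left_mono) auto
    with L[OF that, of 0] show ?thesis by simp
  qed
  show ?thesis
  proof (cases "x \<le> y")
    case True
    then show ?thesis using gauss_op_contraction_aux[OF x y True L B] by simp
  next
    case False
    then show ?thesis using gauss_op_contraction_aux[OF y x _ L B] by (simp add: abs_minus_commute)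
  qed
qed

section \<open>Invariance of the Gauss measure and convergence to the mean\<close>

definition gauss_mean :: "(real \<Rightarrow> real) \<Rightarrow> real" where
  "gauss_mean g = integral {0..1} (\<lambda>t. g t / (1 + t)) / ln 2"

text \<open>Under u = 1 / (k + t) the weight of digit k times dt / (1 + t) becomes du / (1 + u), up
  to orientation, and the images of the branches tile (0, 1]. The sum over k and the integral are
  exchanged by uniform convergence.\<close>

lemma gauss_mean_gauss_op:
  assumes g: "continuous_on {0..1} g"
  shows "gauss_mean (gauss_op g) = gauss_mean g"
proof -
  define f where "f u = g u / (1 + u)" for u
  define h where "h k t = gauss_prob t (real (Suc k)) * g (1 / (real (Suc k) + t)) / (1 + t)" for k t
  have cf: "continuous_on {0..1} f"
    unfolding f_def by (intro continuous_intros g) auto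
  have "compact (g ` {0..1})" using g by (rule compact_continuous_image) simp
  then have "bounded (g ` {0..1})" by (rule compact_imp_bounded)
  then obtain B where B: "\<And>u. u \<in> {0..1} \<Longrightarrow> \<bar>g u\<bar> \<le> B"
    unfolding bounded_real by (metis imageI)
  have B0: "0 \<le> B" using B[of 0] by simp
  have fB: "\<bar>f u\<bar> \<le> B" if "u \<in> {0..1}" for u
  proof -
    have "\<bar>f u\<bar> = \<bar>g u\<bar> / (1 + u)" using that by (simp add: f_def)
    also have "\<dots> \<le> \<bar>g u\<bar> / 1" using that by (intro divide_left_mono) auto
    finally show ?thesis using B[OF that] by simp
  qed
  have heq: "h k t = g (1 / (real (Suc k) + t)) / ((real (Suc k) + t) * (real (Suc k) + t + 1))"
    if "t \<in> {0..1}" for k t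
    using that by (simp add: h_def gauss_prob_def)
  have ch: "continuous_on {0..1} (h k)" for k
    unfolding h_def gauss_prob_def
    by (intro continuous_intros continuous_on_compose2[OF g]) (auto simp: divide_le_eq_1)
  have branch: "(h k has_integral integral {1 / real (Suc (Suc k))..1 / real (Suc k)} f) {0..1}" for k
  proof -
    define \<phi> where "\<phi> t = 1 / (real (Suc k) + t)" for t
    have sub: "((\<lambda>t. (- 1 / (real (Suc k) + t)^2) *\<^sub>R f (\<phi> t)) has_integral
       (integral {\<phi> 0..\<phi> 1} f - integral {\<phi> 1..\<phi> 0} f)) {0..1}"
    proof (rule has_integral_substitution_general[where s="{}" and c=0 and d=1])
      show "\<phi> ` {0..1} \<subseteq> {0..1}" by (auto simp: \<phi>_def field_simps)
      show "continuous_on {0..1} \<phi>" unfolding \<phi>_def by (intro continuous_intros) auto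
      show "(\<phi> has_real_derivative - 1 / (real (Suc k) + x)\<^sup>2) (at x within {0..1})"
        if "x \<in> {0..1} - {}" for x
        unfolding \<phi>_def using that by (auto intro!: derivative_eq_intros simp: power2_eq_square)
    qed (use cf in auto)
    \<comment> \<open>The branch is decreasing, so of the two oriented integrals in the substitution
      rule only the one from \<open>\<phi> 1\<close> to \<open>\<phi> 0\<close> survives, with a
      minus sign.\<close>
    have "{\<phi> 0..\<phi> 1} = {}" by (simp add: \<phi>_def field_simps)
    then have "integral {\<phi> 0..\<phi> 1} f = 0" by simp
    with has_integral_neg[OF sub] have "((\<lambda>t. - ((- 1 / (real (Suc k) + t)^2) *\<^sub>R f (\<phi> t))) has_integral
       integral {\<phi> 1..\<phi> 0} f) {0..1}"
      by (simp only: diff_0 minus_minus)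
    moreover have "- ((- 1 / (real (Suc k) + t)^2) *\<^sub>R f (\<phi> t)) = h k t" if "t \<in> {0..1}" for t
    proof -
      define a where "a = real (Suc k) + t"
      have a: "0 < a" using that by (simp add: a_def)
      have "a\<^sup>2 * (1 + 1 / a) = a * (a + 1)" using a by (simp add: power2_eq_square field_simps)
      then show ?thesis unfolding heq[OF that] \<phi>_def f_def a_def[symmetric] by simp
    qed
    ultimately have "(h k has_integral integral {\<phi> 1..\<phi> 0} f) {0..1}"
      by (rule has_integral_eq[rotated])
    then show ?thesis by (simp add: \<phi>_def add_ac)
  qed
  have part: "(\<Sum>k<n. integral {1 / real (Suc (Suc k))..1 / real (Suc k)} f) = integral {1 / real (Suc n)..1} f" for n
  proof (induction n)
    case (Suc n)
    have "integral {1 / real (Suc (Suc n))..1 / real (Suc n)} f + integral {1 / real (Suc n)..1} f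
        = integral {1 / real (Suc (Suc n))..1} f"
      by (intro Henstock_Kurzweil_Integration.integral_combine integrable_continuous_real continuous_on_subset[OF cf])
         (auto simp: field_simps)
    then show ?case using Suc by simp
  qed simp
  have "(\<lambda>n. integral {1 / real (Suc n)..1} f - integral {0..1} f) \<longlonglongrightarrow> 0"
  proof (rule Lim_null_comparison)
    show "\<forall>\<^sub>F n in sequentially. norm (integral {1 / real (Suc n)..1} f - integral {0..1} f) \<le> B * (1 / real (Suc n) - 0)"
    proof (rule always_eventually, rule allI)
      fix n
      have "integral {0..1 / real (Suc n)} f + integral {1 / real (Suc n)..1} f = integral {0..1} f"
        by (intro Henstock_Kurzweil_Integration.integral_combine integrable_continuous_real cf) (auto simp: field_simps)
      moreover have "norm (integral {0..1 / real (Suc n)} f) \<le> B * (1 / real (Suc n) - 0)"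
      proof (intro integral_bound continuous_on_subset[OF cf])
        have 1: "1 / real (Suc n) \<le> 1" by simp
        then show "{0..1 / real (Suc n)} \<subseteq> {0..1}" by auto
        fix t assume "t \<in> {0..1 / real (Suc n)}"
        with 1 have "t \<in> {0..1}" by (meson atLeastAtMost_iff order_trans)
        then show "norm (f t) \<le> B" using fB by simp
      qed simp
      ultimately show "norm (integral {1 / real (Suc n)..1} f - integral {0..1} f) \<le> B * (1 / real (Suc n) - 0)"
        by (smt (verit) real_norm_def)
    qed
    show "(\<lambda>n. B * (1 / real (Suc n) - 0)) \<longlonglongrightarrow> 0" by real_asymp
  qed
  then have lim1: "(\<lambda>n. integral {1 / real (Suc n)..1} f) \<longlonglongrightarrow> integral {0..1} f"
    by (rule LIM_zero_cancel)
  \<comment> \<open>The factor 1 + t cancels in \<open>h\<close>, and the weight that remains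
    decreases in t; hence the weights at t = 0 give a majorant.\<close>
  have "summable (\<lambda>k. gauss_prob 0 (real (Suc k)) * B)"
    using gauss_prob_sums[of 0] by (intro summable_mult2) (simp add: sums_iff)
  moreover have "norm (h k t) \<le> gauss_prob 0 (real (Suc k)) * B" if "t \<in> {0..1}" for k t
  proof -
    have "norm (h k t) = 1 / ((real (Suc k) + t) * (real (Suc k) + t + 1)) * \<bar>g (1 / (real (Suc k) + t))\<bar>"
      unfolding heq[OF that] using that by (simp add: abs_mult)
    also have "\<dots> \<le> gauss_prob 0 (real (Suc k)) * B"
      unfolding gauss_prob_def using that
      by (intro mult_mono divide_mono B gauss_branch_mem) (auto intro!: mult_mono)
    finally show ?thesis .
  qed
  ultimately have "uniform_limit {0..1} (\<lambda>n x. \<Sum>i<n. h i x) (\<lambda>x. \<Sum>i. h i x) sequentially"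
    by (intro Weierstrass_m_test) auto
  then obtain I J where I: "\<And>n. ((\<lambda>x. \<Sum>i<n. h i x) has_integral I n) {0..1}"
    and J: "((\<lambda>x. \<Sum>i. h i x) has_integral J) {0..1}" and IJ: "I \<longlonglongrightarrow> J"
    by (rule uniform_limit_integral) (auto intro!: continuous_on_sum ch)
  have "I n = integral {1 / real (Suc n)..1} f" for n
    unfolding part[symmetric]
    by (intro has_integral_unique[OF I has_integral_sum] finite_lessThan branch)
  with IJ have "I \<longlonglongrightarrow> integral {0..1} f" using lim1 by presburger
  with IJ have JI: "J = integral {0..1} f" by (rule LIMSEQ_unique)
  have eq: "(\<Sum>i. h i t) = gauss_op g t / (1 + t)" if "t \<in> {0..1}" for t
    using sums_divide[OF gauss_op_sums[of t g B, OF that B], where c = "1 + t"] unfolding h_def sums_iff by simp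
  have "((\<lambda>t. gauss_op g t / (1 + t)) has_integral integral {0..1} f) {0..1}"
    using J unfolding JI by (rule has_integral_eq[rotated]) (rule eq)
  then show ?thesis unfolding gauss_mean_def f_def by (simp add: integral_unique)
qed

lemma gauss_mean_const: "gauss_mean (\<lambda>_. c) = c"
proof -
  have "((\<lambda>t. c / (1 + t)) has_integral (c * ln (1 + 1) - c * ln (1 + 0))) {0..1::real}"
    by (intro fundamental_theorem_of_calculus)
       (auto intro!: derivative_eq_intros simp flip: has_real_derivative_iff_has_vector_derivative)
  then show ?thesis by (simp add: gauss_mean_def integral_unique)
qed

lemma gauss_mean_bound:
  assumes g: "continuous_on {0..1} g" and B: "\<And>t. t \<in> {0..1} \<Longrightarrow> \<bar>g t - c\<bar> \<le> B"
  shows "\<bar>c - gauss_mean g\<bar> \<le> B"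
proof -
  have mono: "gauss_mean u \<le> gauss_mean v"
    if "continuous_on {0..1} u" "continuous_on {0..1} v" "\<And>t. t \<in> {0..1} \<Longrightarrow> u t \<le> v t" for u v
    unfolding gauss_mean_def using that
    by (intro divide_right_mono integral_le integrable_continuous_real continuous_intros) auto
  have "gauss_mean (\<lambda>_. c - B) \<le> gauss_mean g"
    using B by (intro mono g continuous_intros) (force simp: abs_le_iff)
  moreover have "gauss_mean g \<le> gauss_mean (\<lambda>_. c + B)"
    using B by (intro mono g continuous_intros) (force simp: abs_le_iff)
  ultimately show ?thesis by (simp add: gauss_mean_const abs_le_iff)
qed

lemma lipschitz_continuous:
  fixes g :: "real \<Rightarrow> real"
  assumes "\<And>u v. u \<in> S \<Longrightarrow> v \<in> S \<Longrightarrow> \<bar>g u - g v\<bar> \<le> L * \<bar>u - v\<bar>" "0 \<le> L"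
  shows "continuous_on S g"
  by (rule lipschitz_on_continuous_on[of L]) (auto simp: lipschitz_on_def dist_real_def assms)

lemma gauss_op_iterate_lipschitz:
  assumes L: "\<And>u v. u \<in> {0..1} \<Longrightarrow> v \<in> {0..1} \<Longrightarrow> \<bar>g u - g v\<bar> \<le> L * \<bar>u - v\<bar>"
    and "u \<in> {0..1}" "v \<in> {0..1}"
  shows "\<bar>(gauss_op ^^ i) g u - (gauss_op ^^ i) g v\<bar> \<le> (7/8)^i * L * \<bar>u - v\<bar>"
  using assms(2,3)
proof (induction i arbitrary: u v)
  case (Suc i)
  then show ?case using gauss_op_contraction[OF Suc.prems Suc.IH] by simp
qed (use L in auto)

text \<open>All iterates have the same mean, and the oscillation of the i-th iterate on the unit
  interval is at most its Lipschitz constant (7/8)^i L, so each of its values is that close to the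
  mean.\<close>

lemma gauss_op_iterate_converges:
  assumes L: "\<And>u v. u \<in> {0..1} \<Longrightarrow> v \<in> {0..1} \<Longrightarrow> \<bar>g u - g v\<bar> \<le> L * \<bar>u - v\<bar>"
    and t: "t \<in> {0..1}"
  shows "\<bar>(gauss_op ^^ i) g t - gauss_mean g\<bar> \<le> (7/8)^i * L"
proof -
  have L0: "0 \<le> L" using L[of 0 1] by simp
  have c: "continuous_on {0..1} ((gauss_op ^^ j) g)" for j
    using L0 by (intro lipschitz_continuous[OF gauss_op_iterate_lipschitz[OF L]]) auto
  have "gauss_mean ((gauss_op ^^ i) g) = gauss_mean g"
    by (induction i) (simp_all add: gauss_mean_gauss_op c)
  moreover have "\<bar>(gauss_op ^^ i) g t - gauss_mean ((gauss_op ^^ i) g)\<bar> \<le> (7/8)^i * L"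
  proof (intro gauss_mean_bound c)
    fix u :: real assume u: "u \<in> {0..1}"
    have "\<bar>(gauss_op ^^ i) g u - (gauss_op ^^ i) g t\<bar> \<le> (7/8)^i * L * \<bar>u - t\<bar>"
      by (rule gauss_op_iterate_lipschitz[OF L u t])
    also have "\<dots> \<le> (7/8)^i * L * 1" using u t L0 by (intro mult_left_mono) auto
    finally show "\<bar>(gauss_op ^^ i) g u - (gauss_op ^^ i) g t\<bar> \<le> (7/8)^i * L" by simp
  qed
  ultimately show ?thesis by simp
qed

section \<open>Random words\<close>

primrec word_pmf :: "nat \<Rightarrow> real \<Rightarrow> nat list pmf" where
  "word_pmf 0 t = return_pmf []"
| "word_pmf (Suc n) t =
     bind_pmf (digit_pmf t) (\<lambda>k. map_pmf (Cons k) (word_pmf n (1 / (real k + t))))"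

primrec cf_state :: "nat list \<Rightarrow> real \<Rightarrow> real" where
  "cf_state [] t = t"
| "cf_state (k # w) t = cf_state w (1 / (real k + t))"

lemma set_word_pmf:
  "w \<in> set_pmf (word_pmf n t) \<Longrightarrow> length w = n \<and> (\<forall>k\<in>set w. 0 < k)"
  by (induction n arbitrary: t w) (auto dest: set_digit_pmf)

lemma cf_state_mem: "t \<in> {0..1} \<Longrightarrow> \<forall>k\<in>set w. 0 < k \<Longrightarrow> cf_state w t \<in> {0..1}"
proof (induction w arbitrary: t)
  case (Cons k w)
  then have "1 / (real k + t) \<in> {0..1}" by (intro gauss_branch_mem) auto
  with Cons show ?case by simp
qed simp

lemma pmf_word_pmf_Cons:
  assumes "0 \<le> t" "0 < k"
  shows "pmf (word_pmf (Suc n) t) (k # w) = gauss_prob t (real k) * pmf (word_pmf n (1 / (real k + t))) w"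
proof -
  have "pmf (map_pmf (Cons j) M) (k # w) = (if j = k then pmf M w else 0)" for j M
    by (auto simp: pmf_map_inj' inj_on_def intro!: pmf_map_outside)
  then have "pmf (word_pmf (Suc n) t) (k # w) =
      measure_pmf.expectation (digit_pmf t) (\<lambda>j. if j = k then pmf (word_pmf n (1 / (real j + t))) w else 0)"
    by (simp add: pmf_bind)
  also have "\<dots> = gauss_prob t (real k) * pmf (word_pmf n (1 / (real k + t))) w"
    by (subst integral_measure_pmf_real[of "{k}"]) (auto simp: pmf_digit_pmf[OF assms] split: if_splits)
  finally show ?thesis .
qed

text \<open>The Markov property: the second part depends on the first only through its final state.
  This is what allows words to be cut into blocks.\<close>

lemma word_pmf_add:
  "word_pmf (m + n) t = bind_pmf (word_pmf m t) (\<lambda>u. map_pmf (append u) (word_pmf n (cf_state u t)))"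
proof -
  have app: "(@) [] = (\<lambda>v. v)" "(@) (k # u) = (\<lambda>v. k # (u @ v))" for k :: nat and u by auto
  show ?thesis
    by (induction m arbitrary: t)
       (simp_all add: app bind_return_pmf bind_assoc_pmf bind_map_pmf map_bind_pmf map_pmf_comp)
qed

lemma map_take_word_pmf:
  assumes "m \<le> n"
  shows "map_pmf (take m) (word_pmf n t) = word_pmf m t"
proof -
  obtain j where n: "n = m + j" using assms le_Suc_ex by blast
  have "map_pmf (take m) (word_pmf n t) =
      bind_pmf (word_pmf m t) (\<lambda>u. map_pmf (\<lambda>v. take m (u @ v)) (word_pmf j (cf_state u t)))"
    unfolding n word_pmf_add by (simp add: map_bind_pmf map_pmf_comp)
  also have "\<dots> = bind_pmf (word_pmf m t) return_pmf"
    by (intro bind_pmf_cong refl) (auto dest!: set_word_pmf)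
  finally show ?thesis by (simp add: bind_return_pmf')
qed

text \<open>The first \<open>i\<close> digits are averaged out, each by one application of
  \<open>gauss_op\<close>; what remains is the probability of reading \<open>s\<close> from the
  current state. Convergence of the iterates thus becomes convergence of the probability of
  \<open>s\<close> at position \<open>i\<close>.\<close>

lemma pmf_subword:
  assumes "i + length s \<le> n"
  shows "pmf (map_pmf (\<lambda>w. take (length s) (drop i w)) (word_pmf n t)) s
       = (gauss_op ^^ i) (\<lambda>t. pmf (word_pmf (length s) t) s) t"
  using assms
proof (induction i arbitrary: n t)
  case 0
  then show ?case by (simp add: map_take_word_pmf)
next
  case (Suc i)
  then obtain n' where n: "n = Suc n'" by (cases n) auto
  have "pmf (map_pmf (\<lambda>w. take (length s) (drop (Suc i) w)) (word_pmf n t)) s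
      = measure_pmf.expectation (digit_pmf t)
         (\<lambda>k. pmf (map_pmf (\<lambda>w. take (length s) (drop i w)) (word_pmf n' (1 / (real k + t)))) s)"
    unfolding n by (simp add: map_bind_pmf map_pmf_comp pmf_bind)
  also have "\<dots> = measure_pmf.expectation (digit_pmf t)
         (\<lambda>k. (gauss_op ^^ i) (\<lambda>t. pmf (word_pmf (length s) t) s) (1 / (real k + t)))"
    using Suc n by simp
  finally show ?case
    by (simp only: funpow.simps comp_apply gauss_op_def[of "(gauss_op ^^ i) (\<lambda>t. pmf (word_pmf (length s) t) s)"])
qed

section \<open>The probability of a word in closed form\<close>

definition gauss_dist :: "real \<Rightarrow> real \<Rightarrow> real" where
  "gauss_dist t y = (1 + t) * y / (1 + t * y)"

definition cf_val :: "nat list \<Rightarrow> real \<Rightarrow> real" where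
  "cf_val s y = foldr (\<lambda>a z. 1 / (real a + z)) s y"

lemma cf_val_simps [simp]:
  "cf_val [] y = y" "cf_val (a # s) y = 1 / (real a + cf_val s y)"
  by (simp_all add: cf_val_def)

lemma cf_val_mem: "y \<in> {0..1} \<Longrightarrow> \<forall>k\<in>set s. 0 < k \<Longrightarrow> cf_val s y \<in> {0..1}"
proof (induction s)
  case (Cons k s)
  then show ?case using gauss_branch_mem[of k "cf_val s y"] by simp
qed simp

text \<open>\<open>gauss_dist t\<close> is the conditional distribution function of the tail of the
  expansion in state \<open>t\<close>. First digit \<open>a\<close> and next tail below
  \<open>y\<close> mean that the tail lies between 1 / (a + y) and 1 / a, and (1 + t) / (a + t) is
  the value of \<open>gauss_dist t\<close> at 1 / a.\<close>

lemma gauss_prob_dist: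
  assumes "0 < a" "0 \<le> t" "0 \<le> y"
  shows "gauss_prob t a * gauss_dist (1 / (a + t)) y = (1 + t) / (a + t) - gauss_dist t (1 / (a + y))"
proof -
  have pos: "0 < a + t" "0 < a + y" "0 < a + t + y" "0 < a + t + 1" using assms by auto
  have "gauss_dist (1 / (a + t)) y = (a + t + 1) * y / (a + t + y)"
    unfolding gauss_dist_def using pos by (simp add: divide_simps; simp add: algebra_simps)
  moreover have "gauss_dist t (1 / (a + y)) = (1 + t) / (a + t + y)"
    unfolding gauss_dist_def using pos by (simp add: divide_simps; simp add: algebra_simps)
  moreover have "gauss_prob t a * ((a + t + 1) * y / (a + t + y)) = (1 + t) * y / ((a + t) * (a + t + y))"
    unfolding gauss_prob_def using pos by simp
  moreover have "\<dots> = (1 + t) / (a + t) - (1 + t) / (a + t + y)"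
    using pos by (simp add: divide_simps; simp add: algebra_simps)
  ultimately show ?thesis by simp
qed

text \<open>The word \<open>s\<close> describes an interval with end points
  \<open>cf_val s 0\<close> and \<open>cf_val s 1\<close>. Every digit reverses their order, whence
  the sign; the term (1 + t) / (a + t) of the one-digit formula cancels in the difference.\<close>

lemma pmf_word_pmf_eq:
  assumes "t \<in> {0..1}" "\<forall>k\<in>set s. 0 < k"
  shows "pmf (word_pmf (length s) t) s
       = (-1) ^ length s * (gauss_dist t (cf_val s 1) - gauss_dist t (cf_val s 0))"
  using assms
proof (induction s arbitrary: t)
  case Nil
  then show ?case by (simp add: gauss_dist_def)
next
  case (Cons a s)
  have v: "cf_val s 0 \<in> {0..1}" "cf_val s 1 \<in> {0..1}" using Cons.prems cf_val_mem[of 0 s] cf_val_mem[of 1 s] by auto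
  have "pmf (word_pmf (length (a # s)) t) (a # s)
      = gauss_prob t (real a) * ((-1) ^ length s *
          (gauss_dist (1 / (real a + t)) (cf_val s 1) - gauss_dist (1 / (real a + t)) (cf_val s 0)))"
    using Cons by (simp add: pmf_word_pmf_Cons del: word_pmf.simps)
  also have "\<dots> = (-1) ^ length s * (gauss_prob t (real a) * gauss_dist (1 / (real a + t)) (cf_val s 1)
      - gauss_prob t (real a) * gauss_dist (1 / (real a + t)) (cf_val s 0))"
    by (simp add: algebra_simps)
  also have "\<dots> = (-1) ^ length (a # s) * (gauss_dist t (cf_val (a # s) 1) - gauss_dist t (cf_val (a # s) 0))"
    using Cons v by (subst (1 2) gauss_prob_dist) (auto simp: algebra_simps)
  finally show ?case .
qed

text \<open>The difference factors as (u - v) times y (1 - y) over two denominators that are at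
  least 1.\<close>

lemma gauss_dist_lipschitz:
  assumes "u \<in> {0..1}" "v \<in> {0..1}" "y \<in> {0..1}"
  shows "\<bar>gauss_dist u y - gauss_dist v y\<bar> \<le> \<bar>u - v\<bar>"
proof -
  have p: "1 \<le> 1 + u * y" "1 \<le> 1 + v * y" using assms by auto
  then have p1: "1 * 1 \<le> (1 + u * y) * (1 + v * y)" by (intro mult_mono) auto
  have "gauss_dist u y - gauss_dist v y = (u - v) * (y * (1 - y) / ((1 + u * y) * (1 + v * y)))"
    unfolding gauss_dist_def using p by (simp add: divide_simps; simp add: algebra_simps)
  then have "\<bar>gauss_dist u y - gauss_dist v y\<bar> = \<bar>u - v\<bar> * \<bar>y * (1 - y) / ((1 + u * y) * (1 + v * y))\<bar>"
    by (simp add: abs_mult)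
  also have "\<dots> \<le> \<bar>u - v\<bar> * 1"
  proof (intro mult_left_mono)
    have "y * (1 - y) \<le> 1 * 1" using assms by (intro mult_mono) auto
    then have "y * (1 - y) / ((1 + u * y) * (1 + v * y)) \<le> 1" using p1 by (simp add: divide_le_eq_1)
    moreover have "0 \<le> y * (1 - y) / ((1 + u * y) * (1 + v * y))"
      using assms p p1 by (intro divide_nonneg_nonneg) auto
    ultimately show "\<bar>y * (1 - y) / ((1 + u * y) * (1 + v * y))\<bar> \<le> 1" by linarith
  qed simp
  finally show ?thesis by simp
qed

text \<open>Each of the two end points contributes Lipschitz constant 1, however long
  \<open>s\<close> is.\<close>

lemma pmf_word_pmf_lipschitz:
  assumes "u \<in> {0..1}" "v \<in> {0..1}" "\<forall>k\<in>set s. 0 < k"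
  shows "\<bar>pmf (word_pmf (length s) u) s - pmf (word_pmf (length s) v) s\<bar> \<le> 2 * \<bar>u - v\<bar>"
proof -
  have "pmf (word_pmf (length s) u) s - pmf (word_pmf (length s) v) s
    = (-1) ^ length s * ((gauss_dist u (cf_val s 1) - gauss_dist v (cf_val s 1))
        - (gauss_dist u (cf_val s 0) - gauss_dist v (cf_val s 0)))"
    using assms by (simp add: pmf_word_pmf_eq algebra_simps)
  then have "\<bar>pmf (word_pmf (length s) u) s - pmf (word_pmf (length s) v) s\<bar>
     = \<bar>(gauss_dist u (cf_val s 1) - gauss_dist v (cf_val s 1))
        - (gauss_dist u (cf_val s 0) - gauss_dist v (cf_val s 0))\<bar>"
    by (simp add: abs_mult power_abs)
  moreover have "\<bar>gauss_dist u (cf_val s y) - gauss_dist v (cf_val s y)\<bar> \<le> \<bar>u - v\<bar>" if "y \<in> {0..1}" for y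
    using assms that by (intro gauss_dist_lipschitz cf_val_mem) auto
  from this[of 0] this[of 1] have
    "\<bar>gauss_dist u (cf_val s 0) - gauss_dist v (cf_val s 0)\<bar> \<le> \<bar>u - v\<bar>"
    "\<bar>gauss_dist u (cf_val s 1) - gauss_dist v (cf_val s 1)\<bar> \<le> \<bar>u - v\<bar>" by auto
  ultimately show ?thesis
    using abs_triangle_ineq4[of "gauss_dist u (cf_val s 1) - gauss_dist v (cf_val s 1)"
        "gauss_dist u (cf_val s 0) - gauss_dist v (cf_val s 0)"] by simp
qed

text \<open>Since ln (1 + y) / ln 2 is the Gauss measure of [0, y], this is the measure of the
  interval of \<open>s\<close>. It is kept apart from \<open>cylinder\<close>, whose digits obey a
  convention at rationals; the two meet in \<open>gauss_measure_cylinder\<close>.\<close>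

definition word_freq :: "nat list \<Rightarrow> real" where
  "word_freq s = (-1) ^ length s * (ln (1 + cf_val s 1) - ln (1 + cf_val s 0)) / ln 2"

text \<open>Divided by 1 + t, \<open>gauss_dist t y\<close> is y / (1 + t y), with antiderivative ln
  (1 + t y) in t.\<close>

lemma gauss_mean_word_pmf:
  assumes "\<forall>k\<in>set s. 0 < k"
  shows "gauss_mean (\<lambda>t. pmf (word_pmf (length s) t) s) = word_freq s"
proof -
  have d: "((\<lambda>t. gauss_dist t y / (1 + t)) has_integral ln (1 + y)) {0..1}" if "y \<in> {0..1}" for y :: real
  proof -
    have "((\<lambda>t. y / (1 + t * y)) has_integral (ln (1 + 1 * y) - ln (1 + 0 * y))) {0..1}"
    proof (intro fundamental_theorem_of_calculus)
      fix t :: real assume t: "t \<in> {0..1}"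
      then have "0 < 1 + t * y" using that by (simp add: add_pos_nonneg)
      then show "((\<lambda>t. ln (1 + t * y)) has_vector_derivative y / (1 + t * y)) (at t within {0..1})"
        unfolding has_real_derivative_iff_has_vector_derivative[symmetric]
        by (auto intro!: derivative_eq_intros)
    qed simp
    then have "((\<lambda>t. y / (1 + t * y)) has_integral ln (1 + y)) {0..1}" by simp
    then show ?thesis
      by (rule has_integral_eq[rotated]) (auto simp: gauss_dist_def)
  qed
  have v: "cf_val s 0 \<in> {0..1}" "cf_val s 1 \<in> {0..1}" using assms cf_val_mem[of 0 s] cf_val_mem[of 1 s] by auto
  have "((\<lambda>t. (-1) ^ length s * (gauss_dist t (cf_val s 1) / (1 + t) - gauss_dist t (cf_val s 0) / (1 + t)))
     has_integral ((-1) ^ length s * (ln (1 + cf_val s 1) - ln (1 + cf_val s 0)))) {0..1}"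
    by (intro has_integral_mult_right has_integral_diff d v)
  then have "((\<lambda>t. pmf (word_pmf (length s) t) s / (1 + t))
     has_integral ((-1) ^ length s * (ln (1 + cf_val s 1) - ln (1 + cf_val s 0)))) {0..1}"
    by (rule has_integral_eq[rotated]) (use assms in \<open>auto simp: pmf_word_pmf_eq simp flip: diff_divide_distrib\<close>)
  then show ?thesis by (simp add: gauss_mean_def word_freq_def integral_unique)
qed

lemma subword_prob:
  assumes "i + length s \<le> n" "t \<in> {0..1}" "\<forall>k\<in>set s. 0 < k"
  shows "\<bar>pmf (map_pmf (\<lambda>w. take (length s) (drop i w)) (word_pmf n t)) s - word_freq s\<bar> \<le> 2 * (7/8)^i"
  unfolding pmf_subword[OF assms(1)]
  using gauss_op_iterate_converges[OF pmf_word_pmf_lipschitz[OF _ _ assms(3)] assms(2), of i]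
  by (simp add: gauss_mean_word_pmf[OF assms(3)] mult.commute)

text \<open>By \<open>subword_prob\<close> the value is a limit of probabilities.\<close>

lemma word_freq_bounds:
  assumes "\<forall>k\<in>set s. 0 < k"
  shows "0 \<le> word_freq s" "word_freq s \<le> 1"
proof -
  define p where "p i = pmf (map_pmf (\<lambda>w. take (length s) (drop i w)) (word_pmf (i + length s) 0)) s" for i
  have "(\<lambda>i. p i - word_freq s) \<longlonglongrightarrow> 0"
  proof (rule Lim_null_comparison)
    show "(\<lambda>i. 2 * (7/8::real)^i) \<longlonglongrightarrow> 0" by real_asymp
    show "\<forall>\<^sub>F i in sequentially. norm (p i - word_freq s) \<le> 2 * (7/8)^i"
      unfolding p_def using subword_prob[OF order_refl _ assms, of 0] by (intro always_eventually) auto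
  qed
  then have lim: "p \<longlonglongrightarrow> word_freq s" by (rule LIM_zero_cancel)
  show "0 \<le> word_freq s" by (rule LIMSEQ_le_const[OF lim]) (auto simp: p_def)
  show "word_freq s \<le> 1" by (rule LIMSEQ_le_const2[OF lim]) (auto simp: p_def pmf_le_1)
qed

section \<open>Large deviations\<close>

definition occurrences :: "nat list \<Rightarrow> nat list \<Rightarrow> nat" where
  "occurrences s w = card {i. i + length s \<le> length w \<and> take (length s) (drop i w) = s}"

lemma finite_occurrences: "finite {i. i + length s \<le> length w \<and> take (length s) (drop i w) = s}"
  by (rule finite_subset[of _ "{..length w}"]) auto

lemma occurrences_le: "s \<noteq> [] \<Longrightarrow> occurrences s w \<le> length w"
proof -
  assume s: "s \<noteq> []"
  have "occurrences s w \<le> card {..<length w}"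
    unfolding occurrences_def using s by (intro card_mono) (auto simp flip: length_greater_0_conv)
  then show ?thesis by simp
qed

text \<open>Only occurrences that straddle the junction are new, and they start among the last
  \<open>length s\<close> positions of \<open>u\<close>.\<close>

lemma occurrences_append:
  assumes "s \<noteq> []"
  shows "occurrences s u + occurrences s v \<le> occurrences s (u @ v)"
    and "occurrences s (u @ v) \<le> occurrences s u + occurrences s v + length s"
proof -
  define pos where "pos w = {i. i + length s \<le> length w \<and> take (length s) (drop i w) = s}" for w
  define C where "C = {i \<in> pos (u @ v). i < length u \<and> length u < i + length s}"
  have len: "0 < length s" using assms by simp
  have fin: "finite (pos w)" for w unfolding pos_def by (rule finite_occurrences)
  have split: "pos (u @ v) = pos u \<union> (\<lambda>i. length u + i) ` pos v \<union> C"
  proof (intro set_eqI iffI)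
    fix i assume i: "i \<in> pos (u @ v)"
    consider "i + length s \<le> length u" | "length u \<le> i" | "i < length u" "length u < i + length s"
      by linarith
    then show "i \<in> pos u \<union> (\<lambda>i. length u + i) ` pos v \<union> C"
    proof cases
      case 2
      then have "i - length u \<in> pos v" using i by (auto simp: pos_def)
      then have "length u + (i - length u) \<in> (\<lambda>i. length u + i) ` pos v" by (rule imageI)
      then show ?thesis using 2 by simp
    qed (use i in \<open>auto simp: pos_def C_def\<close>)
  qed (auto simp: pos_def C_def)
  have c: "card ((\<lambda>i. length u + i) ` pos v) = card (pos v)" by (rule card_image) (auto simp: inj_on_def)
  have "pos u \<inter> (\<lambda>i. length u + i) ` pos v = {}" using len by (auto simp: pos_def)
  then have d: "card (pos u \<union> (\<lambda>i. length u + i) ` pos v) = card (pos u) + card (pos v)"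
    using fin c by (subst card_Un_disjoint) auto
  have "finite C" using fin by (simp add: C_def)
  have "card (pos u \<union> (\<lambda>i. length u + i) ` pos v) \<le> card (pos (u @ v))"
    using fin \<open>finite C\<close> by (intro card_mono) (auto simp: split)
  then show "occurrences s u + occurrences s v \<le> occurrences s (u @ v)"
    unfolding occurrences_def pos_def[symmetric] d .
  have "card C \<le> card {length u - length s..<length u}"
    by (intro card_mono) (auto simp: C_def)
  then have "card C \<le> length s" by simp
  then show "occurrences s (u @ v) \<le> occurrences s u + occurrences s v + length s"
    unfolding occurrences_def pos_def[symmetric]
    using card_Un_le[of "pos u \<union> (\<lambda>i. length u + i) ` pos v" C] d split by simp
qed

definition deviation :: "nat list \<Rightarrow> nat list \<Rightarrow> real" where
  "deviation s w = real (occurrences s w) - word_freq s * real (length w)"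

lemma deviation_append:
  assumes "s \<noteq> []"
  shows "\<bar>deviation s (u @ v) - deviation s u - deviation s v\<bar> \<le> real (length s)"
proof -
  have "real (occurrences s u) + real (occurrences s v) \<le> real (occurrences s (u @ v))"
    "real (occurrences s (u @ v)) \<le> real (occurrences s u) + real (occurrences s v) + real (length s)"
    using occurrences_append[OF assms, of u v] by linarith+
  then show ?thesis unfolding deviation_def by (simp add: algebra_simps abs_le_iff)
qed

text \<open>For x = -y < 0 it follows from exp y >= 1 + y and (1 + y)(1 - y + y^2) = 1 + y^3 >=
  1.\<close>

lemma exp_le_quadratic: 
  fixes x :: real
  assumes "\<bar>x\<bar> \<le> 1"
  shows "exp x \<le> 1 + x + x\<^sup>2"
proof (cases "0 \<le> x")
  case True
  then show ?thesis using exp_bound[of x] assms by simp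
next
  case False
  define y where "y = - x"
  have y: "0 < y" using False by (simp add: y_def)
  have "1 \<le> 1 + y ^ 3" using y by simp
  also have "\<dots> = (1 + y) * (1 - y + y\<^sup>2)" by (simp add: algebra_simps power2_eq_square power3_eq_cube)
  also have "\<dots> \<le> exp y * (1 - y + y\<^sup>2)"
  proof (intro mult_right_mono)
    have "0 \<le> (y - 1)\<^sup>2 + y" using y by simp
    then show "0 \<le> 1 - y + y\<^sup>2" by (simp add: power2_eq_square algebra_simps)
  qed (simp add: exp_ge_add_one_self)
  finally show ?thesis by (simp add: y_def exp_minus field_simps)
qed

context
  fixes s :: "nat list"
  assumes s_ne: "s \<noteq> []" and s_pos: "\<forall>k\<in>set s. 0 < k"
begin

lemma deviation_le: "\<bar>deviation s w\<bar> \<le> real (length w)"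
proof -
  have "real (occurrences s w) \<le> real (length w)" using occurrences_le[OF s_ne] by simp
  moreover have "word_freq s * real (length w) \<le> 1 * real (length w)"
    using word_freq_bounds[OF s_pos] by (intro mult_right_mono) auto
  moreover have "0 \<le> word_freq s * real (length w)" using word_freq_bounds[OF s_pos] by simp
  ultimately show ?thesis unfolding deviation_def by linarith
qed

text \<open>The errors 2 (7/8)^i at the single positions sum to at most 16, and the last
  \<open>length s - 1\<close> positions, where \<open>s\<close> no longer fits, cost at most
  \<open>length s\<close>. The bound does not grow with \<open>n\<close>, which makes long blocks
  nearly unbiased.\<close>

lemma mean_deviation:
  assumes t: "t \<in> {0..1}"
  shows "\<bar>measure_pmf.expectation (word_pmf n t) (deviation s)\<bar> \<le> 16 + real (length s)"
proof (cases "length s \<le> n")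
  case False
  have "\<bar>measure_pmf.expectation (word_pmf n t) (deviation s)\<bar>
      \<le> measure_pmf.expectation (word_pmf n t) (\<lambda>w. \<bar>deviation s w\<bar>)"
    by (rule integral_abs_bound)
  also have "\<dots> \<le> measure_pmf.expectation (word_pmf n t) (\<lambda>w. real n)"
  proof (rule integral_mono_AE)
    show "integrable (measure_pmf (word_pmf n t)) (\<lambda>w. \<bar>deviation s w\<bar>)"
      using deviation_le by (intro measure_pmf.integrable_const_bound[where B="real n"])
        (auto simp: AE_measure_pmf_iff dest!: set_word_pmf)
    show "AE w in word_pmf n t. \<bar>deviation s w\<bar> \<le> real n"
      using deviation_le by (auto simp: AE_measure_pmf_iff dest!: set_word_pmf)
  qed simp
  finally show ?thesis using False by simp
next
  case True
  define I where "I = {..n - length s}"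
  define p where "p i = pmf (map_pmf (\<lambda>w. take (length s) (drop i w)) (word_pmf n t)) s" for i
  have occ: "real (occurrences s w) = (\<Sum>i\<in>I. indicator ((\<lambda>w. take (length s) (drop i w)) -` {s}) w)"
    if "length w = n" for w
  proof -
    have "{i. i + length s \<le> length w \<and> take (length s) (drop i w) = s} = {i\<in>I. take (length s) (drop i w) = s}"
      using True that by (auto simp: I_def)
    then have "real (occurrences s w) = (\<Sum>i\<in>{i\<in>I. take (length s) (drop i w) = s}. 1)"
      unfolding occurrences_def by simp
    also have "\<dots> = (\<Sum>i\<in>I. if take (length s) (drop i w) = s then 1 else 0)"
      by (rule sum.inter_filter) (simp add: I_def)
    also have "\<dots> = (\<Sum>i\<in>I. indicator ((\<lambda>w. take (length s) (drop i w)) -` {s}) w)"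
      by (intro sum.cong) auto
    finally show ?thesis .
  qed
  have "measure_pmf.expectation (word_pmf n t) (deviation s)
     = measure_pmf.expectation (word_pmf n t)
        (\<lambda>w. (\<Sum>i\<in>I. indicator ((\<lambda>w. take (length s) (drop i w)) -` {s}) w) - word_freq s * real n)"
    by (intro integral_cong_AE) (auto simp: AE_measure_pmf_iff deviation_def occ dest!: set_word_pmf)
  also have "\<dots> = (\<Sum>i\<in>I. p i) - word_freq s * real n"
  proof -
    have int: "integrable (word_pmf n t) (indicat_real A)" for A
      by (rule measure_pmf.integrable_const_bound[where B=1]) auto
    have "p i = measure_pmf.prob (word_pmf n t) ((\<lambda>w. take (length s) (drop i w)) -` {s})" for i
      unfolding p_def by (simp add: pmf.rep_eq)
    then show ?thesis using int
      by (simp add: Bochner_Integration.integral_diff Bochner_Integration.integrable_sum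
          Bochner_Integration.integral_sum measure_pmf.prob_space)
  qed
  also have "\<dots> = (\<Sum>i\<in>I. p i - word_freq s) - word_freq s * (real (length s) - 1)"
    using True by (simp add: sum_subtractf I_def of_nat_diff algebra_simps)
  finally have E: "measure_pmf.expectation (word_pmf n t) (deviation s) =
     (\<Sum>i\<in>I. p i - word_freq s) - word_freq s * (real (length s) - 1)" .
  have "\<bar>\<Sum>i\<in>I. p i - word_freq s\<bar> \<le> (\<Sum>i\<in>I. 2 * (7/8)^i)"
    unfolding p_def using True
    by (intro order_trans[OF sum_abs] sum_mono subword_prob t s_pos) (auto simp: I_def)
  also have "\<dots> \<le> (\<Sum>i. 2 * (7/8::real)^i)"
    by (intro sum_le_suminf summable_mult summable_geometric) (auto simp: I_def)
  also have "\<dots> = 16" by (subst suminf_mult) (auto simp: suminf_geometric intro!: summable_geometric)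
  finally have 1: "\<bar>\<Sum>i\<in>I. p i - word_freq s\<bar> \<le> 16" .
  have l: "1 \<le> real (length s)" using s_ne by (cases s) auto
  then have "word_freq s * (real (length s) - 1) \<le> 1 * (real (length s) - 1)"
    using word_freq_bounds[OF s_pos] by (intro mult_right_mono) auto
  moreover have "0 \<le> word_freq s * (real (length s) - 1)" using word_freq_bounds[OF s_pos] l by simp
  moreover have "\<bar>a - b\<bar> \<le> 16 + l" if "\<bar>a\<bar> \<le> 16" "b \<le> 1 * (l - 1)" "0 \<le> b" for a b l :: real
    using that by (simp add: abs_le_iff)
  ultimately show ?thesis unfolding E using 1 by blast
qed

text \<open>In the quadratic bound for the exponential the linear term is governed by the bounded
  mean, the square by the trivial bound \<open>L\<close> on the deviation;
  \<open>\<theta> * L\<close> at most 1 keeps the exponent in the range of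
  \<open>exp_le_quadratic\<close>. The sign \<open>\<sigma>\<close> serves both tails.\<close>

lemma block_exp_moment:
  assumes t: "t \<in> {0..1}" and \<theta>: "0 < \<theta>" "\<theta> * real L \<le> 1" and \<sigma>: "\<bar>\<sigma>\<bar> = 1"
  shows "(\<integral>\<^sup>+w. ennreal (exp (\<theta> * \<sigma> * deviation s w)) \<partial>word_pmf L t)
     \<le> ennreal (exp (\<theta> * (16 + real (length s)) + (\<theta> * real L)\<^sup>2))"
proof -
  let ?M = "word_pmf L t"
  have bd: "\<bar>\<theta> * \<sigma> * deviation s w\<bar> \<le> \<theta> * real L" if "w \<in> set_pmf ?M" for w
    using deviation_le[of w] set_word_pmf[OF that] \<theta> \<sigma> by (simp add: abs_mult)
  have id: "integrable ?M (deviation s)"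
    using deviation_le by (intro measure_pmf.integrable_const_bound[where B="real L"])
      (auto simp: AE_measure_pmf_iff dest!: set_word_pmf)
  have "(\<integral>\<^sup>+w. ennreal (exp (\<theta> * \<sigma> * deviation s w)) \<partial>?M)
      \<le> (\<integral>\<^sup>+w. ennreal (1 + \<theta> * \<sigma> * deviation s w + (\<theta> * real L)\<^sup>2) \<partial>?M)"
  proof (intro nn_integral_mono_AE, unfold AE_measure_pmf_iff, intro ballI ennreal_leI)
    fix w assume w: "w \<in> set_pmf ?M"
    have "(\<theta> * \<sigma> * deviation s w)\<^sup>2 \<le> (\<theta> * real L)\<^sup>2"
      using power_mono[OF bd[OF w], of 2] by simp
    then show "exp (\<theta> * \<sigma> * deviation s w) \<le> 1 + \<theta> * \<sigma> * deviation s w + (\<theta> * real L)\<^sup>2"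
      using exp_le_quadratic[of "\<theta> * \<sigma> * deviation s w"] bd[OF w] \<theta>(2) by linarith
  qed
  also have "\<dots> = ennreal (measure_pmf.expectation ?M (\<lambda>w. 1 + \<theta> * \<sigma> * deviation s w + (\<theta> * real L)\<^sup>2))"
  proof (intro nn_integral_eq_integral, unfold AE_measure_pmf_iff)
    show "integrable ?M (\<lambda>w. 1 + \<theta> * \<sigma> * deviation s w + (\<theta> * real L)\<^sup>2)"
      using id by (intro Bochner_Integration.integrable_add integrable_mult_right) auto
    show "\<forall>w\<in>set_pmf ?M. 0 \<le> 1 + \<theta> * \<sigma> * deviation s w + (\<theta> * real L)\<^sup>2"
    proof
      fix w assume "w \<in> set_pmf ?M"
      from bd[OF this] \<theta>(2) have "-1 \<le> \<theta> * \<sigma> * deviation s w" by linarith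
      then show "0 \<le> 1 + \<theta> * \<sigma> * deviation s w + (\<theta> * real L)\<^sup>2" by simp
    qed
  qed
  also have "measure_pmf.expectation ?M (\<lambda>w. 1 + \<theta> * \<sigma> * deviation s w + (\<theta> * real L)\<^sup>2)
      = 1 + \<theta> * \<sigma> * measure_pmf.expectation ?M (deviation s) + (\<theta> * real L)\<^sup>2"
    using id by (simp add: measure_pmf.prob_space)
  also have "ennreal \<dots> \<le> ennreal (exp (\<theta> * (16 + real (length s)) + (\<theta> * real L)\<^sup>2))"
  proof (rule ennreal_leI)
    have "\<theta> * \<sigma> * measure_pmf.expectation ?M (deviation s) \<le> \<bar>\<theta> * \<sigma> * measure_pmf.expectation ?M (deviation s)\<bar>"
      by simp
    also have "\<dots> \<le> \<theta> * (16 + real (length s))"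
      using mean_deviation[OF t, of L] \<theta> \<sigma> by (simp add: abs_mult)
    finally show "1 + \<theta> * \<sigma> * measure_pmf.expectation ?M (deviation s) + (\<theta> * real L)\<^sup>2
        \<le> exp (\<theta> * (16 + real (length s)) + (\<theta> * real L)\<^sup>2)"
      using exp_ge_add_one_self[of "\<theta> * (16 + real (length s)) + (\<theta> * real L)\<^sup>2"] by linarith
  qed
  finally show ?thesis .
qed

text \<open>Given the first block, the rest is a random word from another state, and the induction
  hypothesis is uniform in the state. Each junction costs \<open>length s\<close> in the deviation,
  which turns 16 + |s| into 16 + 2 |s|; the \<open>r\<close> left-over digits are bounded
  trivially.\<close>

lemma iterated_exp_moment:
  assumes t: "t \<in> {0..1}" and \<theta>: "0 < \<theta>" "\<theta> * real L \<le> 1" and \<sigma>: "\<bar>\<sigma>\<bar> = 1"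
  shows "(\<integral>\<^sup>+w. ennreal (exp (\<theta> * \<sigma> * deviation s w)) \<partial>word_pmf (m * L + r) t)
     \<le> ennreal (exp (\<theta> * real r + real m * (\<theta> * (16 + 2 * real (length s)) + (\<theta> * real L)\<^sup>2)))"
  using t
proof (induction m arbitrary: t)
  case 0
  have "(\<integral>\<^sup>+w. ennreal (exp (\<theta> * \<sigma> * deviation s w)) \<partial>word_pmf r t)
      \<le> (\<integral>\<^sup>+w. ennreal (exp (\<theta> * real r)) \<partial>word_pmf r t)"
  proof (intro nn_integral_mono_AE, unfold AE_measure_pmf_iff, intro ballI ennreal_leI)
    fix w assume "w \<in> set_pmf (word_pmf r t)"
    then have "\<bar>\<theta> * \<sigma> * deviation s w\<bar> \<le> \<theta> * real r"
      using deviation_le[of w] set_word_pmf \<theta> \<sigma> by (fastforce simp: abs_mult)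
    then show "exp (\<theta> * \<sigma> * deviation s w) \<le> exp (\<theta> * real r)" by simp
  qed
  then show ?case by (simp add: measure_pmf.emeasure_space_1)
next
  case (Suc m)
  define R where "R = exp (\<theta> * real r + real m * (\<theta> * (16 + 2 * real (length s)) + (\<theta> * real L)\<^sup>2))"
  let ?e = "\<lambda>w. ennreal (exp (\<theta> * \<sigma> * deviation s w))"
  have "(\<integral>\<^sup>+w. ?e w \<partial>word_pmf (Suc m * L + r) t)
      = (\<integral>\<^sup>+u. \<integral>\<^sup>+v. ?e (u @ v) \<partial>word_pmf (m * L + r) (cf_state u t) \<partial>word_pmf L t)"
    using word_pmf_add[of L "m * L + r" t] by (simp add: add.assoc)
  also have "\<dots> \<le> (\<integral>\<^sup>+u. ennreal (exp (\<theta> * real (length s)) * R) * ?e u \<partial>word_pmf L t)"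
  proof (intro nn_integral_mono_AE, unfold AE_measure_pmf_iff, intro ballI)
    fix u assume u: "u \<in> set_pmf (word_pmf L t)"
    have st: "cf_state u t \<in> {0..1}" using set_word_pmf[OF u] Suc.prems by (intro cf_state_mem) auto
    have le: "?e (u @ v) \<le> ennreal (exp (\<theta> * real (length s))) * ?e u * ?e v" for v
    proof -
      have "\<bar>\<theta> * \<sigma> * (deviation s (u @ v) - deviation s u - deviation s v)\<bar> \<le> \<theta> * real (length s)"
        using deviation_append[OF s_ne, of u v] \<theta> \<sigma> by (simp add: abs_mult)
      then have "\<theta> * \<sigma> * deviation s (u @ v)
         \<le> \<theta> * real (length s) + \<theta> * \<sigma> * deviation s u + \<theta> * \<sigma> * deviation s v"
        by (simp add: algebra_simps)
      then show ?thesis by (simp flip: ennreal_mult exp_add)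
    qed
    have "(\<integral>\<^sup>+v. ?e (u @ v) \<partial>word_pmf (m * L + r) (cf_state u t))
       \<le> (\<integral>\<^sup>+v. ennreal (exp (\<theta> * real (length s))) * ?e u * ?e v \<partial>word_pmf (m * L + r) (cf_state u t))"
      by (intro nn_integral_mono le)
    also have "\<dots> = ennreal (exp (\<theta> * real (length s))) * ?e u *
        (\<integral>\<^sup>+v. ?e v \<partial>word_pmf (m * L + r) (cf_state u t))"
      by (rule nn_integral_cmult) simp
    also have "\<dots> \<le> ennreal (exp (\<theta> * real (length s))) * ?e u * ennreal R"
      unfolding R_def by (intro mult_left_mono Suc.IH st) auto
    also have "\<dots> = ennreal (exp (\<theta> * real (length s)) * R) * ?e u"
      by (simp add: ennreal_mult R_def mult_ac)
    finally show "(\<integral>\<^sup>+v. ?e (u @ v) \<partial>word_pmf (m * L + r) (cf_state u t))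
        \<le> ennreal (exp (\<theta> * real (length s)) * R) * ?e u" .
  qed
  also have "\<dots> = ennreal (exp (\<theta> * real (length s)) * R) * (\<integral>\<^sup>+u. ?e u \<partial>word_pmf L t)"
    by (rule nn_integral_cmult) simp
  also have "\<dots> \<le> ennreal (exp (\<theta> * real (length s)) * R) *
      ennreal (exp (\<theta> * (16 + real (length s)) + (\<theta> * real L)\<^sup>2))"
    by (intro mult_left_mono block_exp_moment Suc.prems \<theta> \<sigma>) auto
  also have "\<dots> = ennreal (exp (\<theta> * real r + real (Suc m) * (\<theta> * (16 + 2 * real (length s)) + (\<theta> * real L)\<^sup>2)))"
    unfolding R_def by (subst ennreal_mult[symmetric]) (auto simp: algebra_simps simp flip: exp_add)
  finally show ?case .
qed

proposition large_deviation:
  assumes \<epsilon>: "0 < \<epsilon>" "\<epsilon> \<le> 1"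
  obtains \<delta> where "0 < \<delta>"
    "\<And>n t. t \<in> {0..1} \<Longrightarrow> measure_pmf.prob (word_pmf n t) {w. \<epsilon> * real n < \<bar>deviation s w\<bar>} \<le> 6 * exp (- \<delta> * real n)"
proof -
  define K where "K = 16 + 2 * real (length s)"
  \<comment> \<open>With L >= 4 K / \<epsilon> the bias K of a block is at most \<epsilon> / 4 per
    digit.\<close>
  define L where "L = Suc (nat \<lceil>4 * K / \<epsilon>\<rceil>)"
  have "4 * K / \<epsilon> \<le> real L" unfolding L_def by linarith
  then have KL: "K \<le> \<epsilon> * real L / 4" using \<epsilon> by (simp add: field_simps)
  have L0: "0 < real L" by (simp add: L_def)
  \<comment> \<open>This makes the quadratic term equal to \<theta> \<epsilon> / 4 per digit, so the
    moment grows at most like exp (\<theta> \<epsilon> n / 2), against the gain exp (- \<theta>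
    \<epsilon> n) from Markov's inequality.\<close>
  define \<theta> where "\<theta> = \<epsilon> / (4 * real L)"
  have \<theta>: "0 < \<theta>" "\<theta> * real L = \<epsilon> / 4" "\<theta> * real L \<le> 1" using \<epsilon> L0 by (auto simp: \<theta>_def)
  have one: "measure_pmf.prob (word_pmf n t) {w. \<epsilon> * real n < \<sigma> * deviation s w} \<le> 3 * exp (- (\<theta> * \<epsilon> / 2) * real n)"
    if t: "t \<in> {0..1}" and \<sigma>: "\<bar>\<sigma>\<bar> = 1" for n t \<sigma>
  proof -
    define m where "m = n div L"
    define r where "r = n mod L"
    have n: "n = m * L + r" by (simp add: m_def r_def)
    have "r < L" unfolding r_def by (rule mod_less_divisor) (simp add: L_def)
    then have rL: "real r \<le> real L" by simp
    have ex: "\<theta> * real r + real m * (\<theta> * K + (\<theta> * real L)\<^sup>2) \<le> 1 + \<theta> * \<epsilon> / 2 * real n"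
    proof -
      have "\<theta> * real r \<le> \<theta> * real L" using \<theta> rL by simp
      also have "\<dots> \<le> 1" by (rule \<theta>)
      finally have "\<theta> * real r \<le> 1" .
      moreover have "\<theta> * K \<le> \<theta> * (\<epsilon> * real L / 4)" using KL \<theta> by (intro mult_left_mono) auto
      moreover have "(\<theta> * real L)\<^sup>2 = \<theta> * (\<epsilon> * real L / 4)"
        unfolding power2_eq_square by (subst (2) \<theta>(2)) simp
      ultimately have "\<theta> * K + (\<theta> * real L)\<^sup>2 \<le> \<theta> * \<epsilon> / 2 * real L" by simp
      then have "real m * (\<theta> * K + (\<theta> * real L)\<^sup>2) \<le> real m * (\<theta> * \<epsilon> / 2 * real L)"
        by (intro mult_left_mono) auto
      also have "\<dots> = \<theta> * \<epsilon> / 2 * real (m * L)" by simp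
      also have "\<dots> \<le> \<theta> * \<epsilon> / 2 * real n" using \<theta> \<epsilon> n by (intro mult_left_mono) auto
      finally show ?thesis using \<open>\<theta> * real r \<le> 1\<close> by linarith
    qed
    let ?A = "{w. \<epsilon> * real n < \<sigma> * deviation s w}"
    have "emeasure (word_pmf n t) ?A = (\<integral>\<^sup>+w. indicator ?A w \<partial>word_pmf n t)" by simp
    also have "\<dots> \<le> (\<integral>\<^sup>+w. ennreal (exp (- \<theta> * \<epsilon> * real n)) * ennreal (exp (\<theta> * \<sigma> * deviation s w)) \<partial>word_pmf n t)"
    proof (intro nn_integral_mono)
      fix w
      show "indicator ?A w \<le> ennreal (exp (- \<theta> * \<epsilon> * real n)) * ennreal (exp (\<theta> * \<sigma> * deviation s w))"
      proof (cases "w \<in> ?A")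
        case True
        then have "\<theta> * (\<epsilon> * real n) \<le> \<theta> * (\<sigma> * deviation s w)" using \<theta> by (intro mult_left_mono) auto
        then have "1 \<le> exp (- \<theta> * \<epsilon> * real n) * exp (\<theta> * \<sigma> * deviation s w)"
          by (simp add: algebra_simps flip: exp_add)
        then show ?thesis using True by (simp flip: ennreal_mult)
      qed simp
    qed
    also have "\<dots> = ennreal (exp (- \<theta> * \<epsilon> * real n)) * (\<integral>\<^sup>+w. ennreal (exp (\<theta> * \<sigma> * deviation s w)) \<partial>word_pmf n t)"
      by (rule nn_integral_cmult) simp
    also have "\<dots> \<le> ennreal (exp (- \<theta> * \<epsilon> * real n)) *
        ennreal (exp (\<theta> * real r + real m * (\<theta> * K + (\<theta> * real L)\<^sup>2)))"
      unfolding K_def by (subst (2) n, intro mult_left_mono iterated_exp_moment t \<theta> \<sigma>) auto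
    also have "\<dots> \<le> ennreal (exp (- \<theta> * \<epsilon> * real n)) * ennreal (exp (1 + \<theta> * \<epsilon> / 2 * real n))"
      using ex by (intro mult_left_mono ennreal_leI) auto
    \<comment> \<open>The factor exp 1 pays for the incomplete block; it is rounded up to 3, and the
      two signs of the deviation make 6.\<close>
    also have "\<dots> = ennreal (exp 1 * exp (- (\<theta> * \<epsilon> / 2) * real n))"
      by (subst ennreal_mult[symmetric]) (auto simp: algebra_simps simp flip: exp_add)
    also have "\<dots> \<le> ennreal (3 * exp (- (\<theta> * \<epsilon> / 2) * real n))"
      using exp_le by (intro ennreal_leI mult_right_mono) auto
    finally show ?thesis by (simp add: measure_pmf.emeasure_eq_measure)
  qed
  show ?thesis
  proof (rule that[of "\<theta> * \<epsilon> / 2"])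
    fix n and t :: real assume t: "t \<in> {0..1}"
    have "measure_pmf.prob (word_pmf n t) {w. \<epsilon> * real n < \<bar>deviation s w\<bar>}
       \<le> measure_pmf.prob (word_pmf n t) ({w. \<epsilon> * real n < 1 * deviation s w} \<union> {w. \<epsilon> * real n < (-1) * deviation s w})"
      by (intro measure_pmf.finite_measure_mono) auto
    also have "\<dots> \<le> measure_pmf.prob (word_pmf n t) {w. \<epsilon> * real n < 1 * deviation s w}
        + measure_pmf.prob (word_pmf n t) {w. \<epsilon> * real n < (-1) * deviation s w}"
      by (intro measure_Un_le) auto
    also have "\<dots> \<le> 3 * exp (- (\<theta> * \<epsilon> / 2) * real n) + 3 * exp (- (\<theta> * \<epsilon> / 2) * real n)"
      by (intro add_mono one t) auto
    finally show "measure_pmf.prob (word_pmf n t) {w. \<epsilon> * real n < \<bar>deviation s w\<bar>} \<le> 6 * exp (- (\<theta> * \<epsilon> / 2) * real n)"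
      by simp
  qed (use \<theta> \<epsilon> in auto)
qed

end

section \<open>Words of rational numbers\<close>

declare cf_euclid.simps [simp del]

text \<open>The word \<open>a # w\<close> stands for 1 / (a + p / q) with p / q the value of
  \<open>w\<close>, so the denominator of \<open>w\<close> becomes the new numerator.\<close>

fun cf_num :: "nat list \<Rightarrow> nat" and cf_den :: "nat list \<Rightarrow> nat" where
  "cf_num [] = 0"
| "cf_num (a # w) = cf_den w"
| "cf_den [] = 1"
| "cf_den (a # w) = a * cf_den w + cf_num w"

lemma cf_den_pos_num_le:
  "\<forall>k\<in>set w. 0 < k \<Longrightarrow> 0 < cf_den w \<and> cf_num w \<le> cf_den w"
proof (induction w)
  case (Cons a w)
  then have "1 * cf_den w \<le> a * cf_den w" by (intro mult_le_mono1) auto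
  then have "cf_den w \<le> a * cf_den w" by (simp only: mult_1)
  with Cons show ?case by (auto simp del: nat_mult_le_cancel1 mult_le_cancel2 intro: trans_le_add1)
qed simp

text \<open>Prefixing two digits at least doubles the denominator; hence a fraction with denominator
  at most Q has only O(log Q) digits.\<close>

lemma two_power_le_cf_den: "\<forall>k\<in>set w. 0 < k \<Longrightarrow> 2 ^ (length w div 2) \<le> cf_den w"
proof (induction w rule: induct_list012)
  case (3 a b w)
  have IH: "2 ^ (length w div 2) \<le> cf_den w" using 3 by simp
  have "1 * cf_den w \<le> b * cf_den w" using 3 by (intro mult_le_mono1) auto
  then have "cf_den w \<le> cf_den (b # w)" unfolding cf_den.simps(2) by linarith
  moreover have "1 * cf_den (b # w) \<le> a * cf_den (b # w)" using 3(3) by (intro mult_le_mono1) auto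
  ultimately have "2 * cf_den w \<le> cf_den (a # b # w)"
    unfolding cf_den.simps(2)[of a] cf_num.simps(2) by linarith
  then show ?case using IH by simp
qed auto

text \<open>As functions of the state, both sides satisfy the same recursion in the first digit,
  which is why \<open>t\<close> is general; the only loss is (1 + t) / 2 <= 1 at the empty word. At
  t = 0 the bound is 1 / (2 q^2).\<close>

lemma pmf_word_pmf_ge:
  assumes "t \<in> {0..1}" "\<forall>k\<in>set w. 0 < k"
  shows "(1 + t) / (2 * (real (cf_den w) + t * real (cf_num w))\<^sup>2) \<le> pmf (word_pmf (length w) t) w"
  using assms
proof (induction w arbitrary: t)
  case (Cons a w)
  define u where "u = 1 / (real a + t)"
  define x where "x = real a + t"
  have x: "0 < x" using Cons.prems by (simp add: x_def add_pos_nonneg)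
  have u: "u \<in> {0..1}" unfolding u_def using Cons.prems by (intro gauss_branch_mem) auto
  define q where "q = real (cf_den w)"
  define p where "p = real (cf_num w)"
  have q: "0 < q" using cf_den_pos_num_le[of w] Cons.prems by (simp add: q_def)
  have p: "0 \<le> p" by (simp add: p_def)
  have pos: "0 < x * q + p" using x q p by (simp add: add_pos_nonneg)
  have "(1 + t) / (2 * (real (cf_den (a # w)) + t * real (cf_num (a # w)))\<^sup>2) = (1 + t) / (2 * (x * q + p)\<^sup>2)"
    by (simp add: x_def q_def p_def algebra_simps)
  also have "\<dots> = gauss_prob t (real a) * ((1 + u) / (2 * (q + u * p)\<^sup>2))"
  proof -
    have ux: "u = 1 / x" by (simp add: u_def x_def)
    have "q + u * p = (x * q + p) / x" "1 + u = (x + 1) / x"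
      unfolding ux using x by (simp_all add: field_simps)
    then have "(1 + u) / (2 * (q + u * p)\<^sup>2) = (x + 1) / x / (2 * ((x * q + p) / x)\<^sup>2)"
      by simp
    also have "\<dots> = x * (x + 1) / (2 * (x * q + p)\<^sup>2)"
      using x pos by (simp add: power_divide power2_eq_square)
    finally show ?thesis using x by (simp add: gauss_prob_def x_def[symmetric])
  qed
  also have "\<dots> \<le> gauss_prob t (real a) * pmf (word_pmf (length w) u) w"
    unfolding q_def p_def using Cons.prems u
    by (intro mult_left_mono Cons.IH gauss_prob_nonneg) auto
  also have "\<dots> = pmf (word_pmf (length (a # w)) t) (a # w)"
    using Cons.prems pmf_word_pmf_Cons[of t a "length w" w] by (simp add: u_def del: word_pmf.simps)
  finally show ?case .
qed simp

section \<open>Euclid's algorithm and the longer expansion; counting words\<close>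

lemma cf_euclid_ne: "0 < p \<Longrightarrow> cf_euclid p q \<noteq> []"
  by (subst cf_euclid.simps) simp

lemma cf_long_rec:
  assumes "0 < p"
  shows "cf_long p q = (if q mod p = 0 then [q div p - 1, 1] else q div p # cf_long (q mod p) p)"
proof (cases "q mod p = 0")
  case True
  then show ?thesis using assms unfolding cf_long_def by (subst cf_euclid.simps) simp
next
  case False
  then have "cf_euclid p q = q div p # cf_euclid (q mod p) p"
    using assms by (subst cf_euclid.simps) simp
  moreover have "cf_euclid (q mod p) p \<noteq> []" using False by (intro cf_euclid_ne) simp
  ultimately show ?thesis using False unfolding cf_long_def Let_def by simp
qed

text \<open>Euclid's algorithm ends at p = 1, where the last two digits are q - 1 and 1. The strict
  inequality p < q makes q - 1 positive and passes to the next pair (q mod p, p).\<close>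

lemma cf_long_properties:
  assumes "0 < p" "p < q" "coprime p q"
  shows "cf_num (cf_long p q) = p \<and> cf_den (cf_long p q) = q \<and> (\<forall>k\<in>set (cf_long p q). 0 < k)"
  using assms
proof (induction p arbitrary: q rule: less_induct)
  case (less p)
  show ?case
  proof (cases "q mod p = 0")
    case True
    then have "p dvd q" by auto
    with less.prems have "p = 1" by (meson coprime_common_divisor_nat dvd_refl is_unit_gcd coprime_absorb_left nat_dvd_1_iff_1)
    then show ?thesis using less.prems by (simp add: cf_long_rec)
  next
    case False
    then have r: "0 < q mod p" "q mod p < p" using less.prems by auto
    have c: "coprime (q mod p) p" using less.prems by (simp add: coprime_commute)
    have d: "0 < q div p" using less.prems by (simp add: div_greater_zero_iff)
    show ?thesis using less.IH[OF r(2) r(1) r(2) c] d False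
      by (simp add: cf_long_rec[OF less.prems(1)] div_mult_mod_eq)
  qed
qed

text \<open>Each word of \<open>W\<close> has mass at least 1 / (2 Q^2), so an event of small
  probability contains few words of bounded denominator.\<close>

lemma card_words_le_prob:
  assumes W: "finite W" "\<And>w. w \<in> W \<Longrightarrow> length w = n \<and> (\<forall>k\<in>set w. 0 < k) \<and> real (cf_den w) \<le> Q"
    and Q: "0 < Q"
  shows "real (card W) \<le> 2 * Q\<^sup>2 * measure_pmf.prob (word_pmf n 0) W"
proof -
  have "1 \<le> 2 * Q\<^sup>2 * pmf (word_pmf n 0) w" if w: "w \<in> W" for w
  proof -
    have d: "0 < real (cf_den w)" "real (cf_den w) \<le> Q" using W(2)[OF w] cf_den_pos_num_le[of w] by auto
    have "1 / (2 * Q\<^sup>2) \<le> 1 / (2 * (real (cf_den w))\<^sup>2)"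
      using d Q by (intro divide_left_mono mult_left_mono power_mono) auto
    also have "\<dots> \<le> pmf (word_pmf n 0) w" using pmf_word_pmf_ge[of 0 w] W(2)[OF w] by simp
    finally show ?thesis using Q by (simp add: field_simps)
  qed
  then have "(\<Sum>w\<in>W. 1) \<le> (\<Sum>w\<in>W. 2 * Q\<^sup>2 * pmf (word_pmf n 0) w)" by (intro sum_mono)
  then show ?thesis using W(1) by (simp add: measure_measure_pmf_finite sum_distrib_left)
qed

text \<open>\<open>Suc k\<close> bounds the factor by which a digit \<open>k\<close> enlarges the
  denominator. The series is dominated by k^(-3/2); the summand 3 added to it makes ln B positive
  later.\<close>

lemma digit_sqrt_moment:
  obtains B :: real where "3 \<le> B"
    "\<And>t. t \<in> {0..1} \<Longrightarrow> (\<integral>\<^sup>+k. ennreal (sqrt (real (Suc k))) \<partial>digit_pmf t) \<le> ennreal B"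
proof -
  define g where "g k = 2 * real (Suc k) powr (-3/2)" for k
  have sg: "summable g"
  proof -
    have "summable (\<lambda>k. real k powr (-3/2))" by (simp add: summable_real_powr_iff)
    then have "summable (\<lambda>k. real (Suc k) powr (-3/2))" by (subst summable_Suc_iff)
    then show ?thesis unfolding g_def by (rule summable_mult)
  qed
  have g0: "0 \<le> g k" for k by (simp add: g_def)
  have "(\<integral>\<^sup>+k. ennreal (sqrt (real (Suc k))) \<partial>digit_pmf t) \<le> ennreal (suminf g + 3)" if t: "t \<in> {0..1}" for t
  proof -
    have le: "gauss_prob t (real (Suc k)) * sqrt (real (Suc (Suc k))) \<le> g k" for k
    proof -
      define m where "m = real (Suc k)"
      have m: "1 \<le> m" by (simp add: m_def)
      have "gauss_prob t m \<le> 2 / (m * (m + 1))"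
        unfolding gauss_prob_def using t m by (intro divide_mono mult_mono) auto
      then have "gauss_prob t m * sqrt (m + 1) \<le> 2 / (m * (m + 1)) * sqrt (m + 1)"
        using m by (intro mult_right_mono) auto
      also have "\<dots> = 2 / (m * sqrt (m + 1))"
      proof -
        define r where "r = sqrt (m + 1)"
        have "m + 1 = r * r" "0 < r" using m by (simp_all add: r_def)
        then show ?thesis using m unfolding r_def[symmetric] by simp
      qed
      also have "\<dots> \<le> 2 / (m * sqrt m)" using m by (intro divide_left_mono mult_left_mono) auto
      also have "m * sqrt m = m powr (3/2)"
      proof -
        have "m powr (3/2) = m powr (1 + 1/2)" by simp
        also have "\<dots> = m * sqrt m" using m by (subst powr_add) (simp add: powr_half_sqrt)
        finally show ?thesis by simp
      qed
      also have "2 / m powr (3/2) = 2 * m powr (-3/2)" by (simp add: powr_minus field_simps)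
      finally show ?thesis by (simp add: g_def m_def add_ac)
    qed
    have "(\<integral>\<^sup>+k. ennreal (sqrt (real (Suc k))) \<partial>digit_pmf t)
       = (\<Sum>k. ennreal (gauss_prob t (real (Suc k))) * ennreal (sqrt (real (Suc (Suc k)))))"
      using t by (subst nn_integral_digit_pmf) auto
    also have "\<dots> \<le> (\<Sum>k. ennreal (g k))"
    proof (intro suminf_le allI)
      fix k
      have "ennreal (gauss_prob t (real (Suc k))) * ennreal (sqrt (real (Suc (Suc k))))
          = ennreal (gauss_prob t (real (Suc k)) * sqrt (real (Suc (Suc k))))"
        using t by (intro ennreal_mult[symmetric] gauss_prob_nonneg) auto
      also have "\<dots> \<le> ennreal (g k)" by (intro ennreal_leI le)
      finally show "ennreal (gauss_prob t (real (Suc k))) * ennreal (sqrt (real (Suc (Suc k)))) \<le> ennreal (g k)" .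
    qed auto
    also have "\<dots> = ennreal (suminf g)" using g0 sg by (rule suminf_ennreal2)
    also have "\<dots> \<le> ennreal (suminf g + 3)" by (intro ennreal_leI) simp
    finally show ?thesis .
  qed
  moreover have "3 \<le> suminf g + 3" using suminf_nonneg[OF sg g0] by simp
  ultimately show ?thesis using that by blast
qed

text \<open>\<open>B\<close> bounds the contribution of one digit from every state, so the bounds
  multiply in spite of the dependence between digits.\<close>

lemma word_sqrt_moment:
  assumes B: "\<And>t. t \<in> {0..1} \<Longrightarrow> (\<integral>\<^sup>+k. ennreal (sqrt (real (Suc k))) \<partial>digit_pmf t) \<le> ennreal B"
    and "0 \<le> B" and "t \<in> {0..1}"
  shows "(\<integral>\<^sup>+w. ennreal (sqrt (real (cf_den w))) \<partial>word_pmf n t) \<le> ennreal (B ^ n)"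
  using assms(3)
proof (induction n arbitrary: t)
  case (Suc n)
  have "(\<integral>\<^sup>+w. ennreal (sqrt (real (cf_den w))) \<partial>word_pmf (Suc n) t)
     = (\<integral>\<^sup>+k. \<integral>\<^sup>+w. ennreal (sqrt (real (cf_den (k # w)))) \<partial>word_pmf n (1 / (real k + t)) \<partial>digit_pmf t)"
    by simp
  also have "\<dots> \<le> (\<integral>\<^sup>+k. ennreal (sqrt (real (Suc k))) * ennreal (B ^ n) \<partial>digit_pmf t)"
  proof (intro nn_integral_mono_AE, unfold AE_measure_pmf_iff, intro ballI)
    fix k assume "k \<in> set_pmf (digit_pmf t)"
    then have k: "0 < k" by (rule set_digit_pmf)
    then have u: "1 / (real k + t) \<in> {0..1}" using Suc.prems by (intro gauss_branch_mem) auto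
    have "(\<integral>\<^sup>+w. ennreal (sqrt (real (cf_den (k # w)))) \<partial>word_pmf n (1 / (real k + t)))
       \<le> (\<integral>\<^sup>+w. ennreal (sqrt (real (Suc k))) * ennreal (sqrt (real (cf_den w))) \<partial>word_pmf n (1 / (real k + t)))"
    proof (intro nn_integral_mono_AE, unfold AE_measure_pmf_iff, intro ballI)
      fix w assume "w \<in> set_pmf (word_pmf n (1 / (real k + t)))"
      then have "cf_num w \<le> cf_den w" using set_word_pmf cf_den_pos_num_le by blast
      then have "cf_den (k # w) \<le> Suc k * cf_den w" by simp
      then have "real (cf_den (k # w)) \<le> real (Suc k) * real (cf_den w)" by (metis of_nat_le_iff of_nat_mult)
      then have "sqrt (real (cf_den (k # w))) \<le> sqrt (real (Suc k)) * sqrt (real (cf_den w))"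
        by (metis real_sqrt_le_mono real_sqrt_mult)
      then show "ennreal (sqrt (real (cf_den (k # w)))) \<le> ennreal (sqrt (real (Suc k))) * ennreal (sqrt (real (cf_den w)))"
        by (subst ennreal_mult[symmetric]) (auto intro!: ennreal_leI)
    qed
    also have "\<dots> = ennreal (sqrt (real (Suc k))) * (\<integral>\<^sup>+w. ennreal (sqrt (real (cf_den w))) \<partial>word_pmf n (1 / (real k + t)))"
      by (rule nn_integral_cmult) simp
    also have "\<dots> \<le> ennreal (sqrt (real (Suc k))) * ennreal (B ^ n)"
      by (intro mult_left_mono Suc.IH u) auto
    finally show "(\<integral>\<^sup>+w. ennreal (sqrt (real (cf_den (k # w)))) \<partial>word_pmf n (1 / (real k + t)))
       \<le> ennreal (sqrt (real (Suc k))) * ennreal (B ^ n)" .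
  qed
  also have "\<dots> = (\<integral>\<^sup>+k. ennreal (sqrt (real (Suc k))) \<partial>digit_pmf t) * ennreal (B ^ n)"
    by (rule nn_integral_multc) simp
  also have "\<dots> \<le> ennreal B * ennreal (B ^ n)"
    by (intro mult_right_mono B Suc.prems) auto
  also have "\<dots> = ennreal (B ^ Suc n)" using assms(2) by (simp add: ennreal_mult)
  finally show ?case .
qed simp

text \<open>For d <= Q, mass at least 1 / (2 d^2) times sqrt d is at least 1 / (2 Q^(3/2)). This
  saves sqrt Q over \<open>card_words_le_prob\<close> at the price B^n, which is cheap for short
  words.\<close>

lemma card_words_le_sqrt_moment:
  assumes W: "finite W" "\<And>w. w \<in> W \<Longrightarrow> length w = n \<and> (\<forall>k\<in>set w. 0 < k) \<and> real (cf_den w) \<le> Q"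
    and Q: "0 < Q"
    and B: "\<And>t. t \<in> {0..1} \<Longrightarrow> (\<integral>\<^sup>+k. ennreal (sqrt (real (Suc k))) \<partial>digit_pmf t) \<le> ennreal B" "0 \<le> B"
  shows "real (card W) \<le> 2 * (Q * sqrt Q) * B ^ n"
proof -
  have one: "1 \<le> 2 * (Q * sqrt Q) * (sqrt (real (cf_den w)) * pmf (word_pmf n 0) w)" if w: "w \<in> W" for w
  proof -
    define d where "d = real (cf_den w)"
    have d: "0 < d" "d \<le> Q" using W(2)[OF w] cf_den_pos_num_le[of w] by (auto simp: d_def)
    have "1 \<le> (Q * sqrt Q) / (d * sqrt d)"
      using d by (auto intro!: mult_mono simp: field_simps)
    also have "\<dots> = 2 * (Q * sqrt Q) * (sqrt d * (1 / (2 * d\<^sup>2)))"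
    proof -
      have "d\<^sup>2 = d * sqrt d * sqrt d" using d by (simp add: power2_eq_square)
      then show ?thesis using d by (simp add: field_simps)
    qed
    also have "\<dots> \<le> 2 * (Q * sqrt Q) * (sqrt d * pmf (word_pmf n 0) w)"
      using pmf_word_pmf_ge[of 0 w] W(2)[OF w] d Q by (intro mult_left_mono) (auto simp: d_def)
    finally show ?thesis by (simp add: d_def)
  qed
  have "real (card W) = (\<Sum>w\<in>W. 1)" by simp
  also have "\<dots> \<le> (\<Sum>w\<in>W. 2 * (Q * sqrt Q) * (sqrt (real (cf_den w)) * pmf (word_pmf n 0) w))"
    by (intro sum_mono one)
  also have "\<dots> = 2 * (Q * sqrt Q) * (\<Sum>w\<in>W. sqrt (real (cf_den w)) * pmf (word_pmf n 0) w)"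
    by (simp add: sum_distrib_left)
  also have "\<dots> \<le> 2 * (Q * sqrt Q) * B ^ n"
  proof (intro mult_left_mono)
    have "ennreal (\<Sum>w\<in>W. sqrt (real (cf_den w)) * pmf (word_pmf n 0) w)
       = (\<Sum>w\<in>W. (ennreal (sqrt (real (cf_den w))) * indicator W w) * ennreal (pmf (word_pmf n 0) w))"
      by (simp add: ennreal_mult flip: sum_ennreal cong: sum.cong)
    also have "\<dots> = (\<integral>\<^sup>+w. ennreal (sqrt (real (cf_den w))) * indicator W w \<partial>word_pmf n 0)"
      by (rule nn_integral_measure_pmf_support[symmetric]) (use W(1) in auto)
    also have "\<dots> \<le> (\<integral>\<^sup>+w. ennreal (sqrt (real (cf_den w))) \<partial>word_pmf n 0)"
      by (intro nn_integral_mono) (auto simp: indicator_def)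
    also have "\<dots> \<le> ennreal (B ^ n)" by (intro word_sqrt_moment B) auto
    finally show "(\<Sum>w\<in>W. sqrt (real (cf_den w)) * pmf (word_pmf n 0) w) \<le> B ^ n"
      using B(2) by (subst (asm) ennreal_le_iff) auto
  qed (use Q in auto)
  finally show ?thesis .
qed

section \<open>Numbers with prescribed digits and the measure of cylinders\<close>

text \<open>The intervals are closed, so that compactness gives a point common to all of them; its
  digits are identified afterwards.\<close>

primrec cf_interval :: "nat \<Rightarrow> (nat \<Rightarrow> nat) \<Rightarrow> real set" where
  "cf_interval 0 a = {0..1}"
| "cf_interval (Suc n) a = (\<lambda>y. 1 / (real (a 0) + y)) ` cf_interval n (\<lambda>i. a (Suc i))"

lemma cf_interval_subset: "\<forall>i. 0 < a i \<Longrightarrow> cf_interval n a \<subseteq> {0..1}"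
proof (induction n arbitrary: a)
  case (Suc n)
  have "cf_interval n (\<lambda>i. a (Suc i)) \<subseteq> {0..1}" using Suc by simp
  moreover have "0 < a 0" using Suc.prems by simp
  ultimately show ?case using gauss_branch_mem[of "a 0"] by auto
qed simp

lemma cf_interval_compact_ne: "\<forall>i. 0 < a i \<Longrightarrow> compact (cf_interval n a) \<and> cf_interval n a \<noteq> {}"
proof (induction n arbitrary: a)
  case (Suc n)
  have IH: "compact (cf_interval n (\<lambda>i. a (Suc i)))" "cf_interval n (\<lambda>i. a (Suc i)) \<noteq> {}"
    using Suc by simp_all
  have sub: "cf_interval n (\<lambda>i. a (Suc i)) \<subseteq> {0..1}" using Suc.prems by (intro cf_interval_subset) simp
  have "0 < real (a 0)" using Suc.prems by simp
  then have "continuous_on (cf_interval n (\<lambda>i. a (Suc i))) (\<lambda>y. 1 / (real (a 0) + y))"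
    using sub by (intro continuous_intros) (auto simp: add_eq_0_iff dest!: subsetD)
  then show ?case using IH by (auto intro!: compact_continuous_image)
qed simp

lemma cf_interval_Suc_subset: "\<forall>i. 0 < a i \<Longrightarrow> cf_interval (Suc n) a \<subseteq> cf_interval n a"
proof (induction n arbitrary: a)
  case 0
  then show ?case using cf_interval_subset[of a "Suc 0"] by simp
next
  case (Suc n)
  have "cf_interval (Suc n) (\<lambda>i. a (Suc i)) \<subseteq> cf_interval n (\<lambda>i. a (Suc i))"
    using Suc.prems by (intro Suc.IH) simp
  then show ?case unfolding cf_interval.simps(2)[of "Suc n" a] cf_interval.simps(2)[of n a]
    by (rule image_mono)
qed

lemma cf_orbit_exists:
  fixes a :: "nat \<Rightarrow> nat"
  assumes a: "\<forall>i. 0 < a i"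
  obtains y :: "nat \<Rightarrow> real" where "\<And>n. 0 < y n" "\<And>n. y n < 1" "\<And>n. 1 / y n = real (a n) + y (Suc n)"
proof -
  have "(\<Inter>n. cf_interval n a) \<noteq> {}"
  proof (rule compact_nest)
    show "compact (cf_interval n a)" "cf_interval n a \<noteq> {}" for n
      using cf_interval_compact_ne[OF a] by auto
    show "cf_interval n a \<subseteq> cf_interval m a" if "m \<le> n" for m n
      using that by (induction rule: dec_induct) (use cf_interval_Suc_subset[OF a] in auto)
  qed
  then obtain x where x: "\<And>n. x \<in> cf_interval n a" by auto
  \<comment> \<open>The orbit subtracts the prescribed digit instead of the floor; that the two
    agree follows once the orbit is known to lie strictly between 0 and 1.\<close>
  define y where "y = rec_nat x (\<lambda>n z. 1 / z - real (a n))"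
  have y0: "y 0 = x" and ys: "y (Suc n) = 1 / y n - real (a n)" for n by (simp_all add: y_def)
  have step: "1 / z - real (b 0) \<in> cf_interval n (\<lambda>i. b (Suc i))"
    if "z \<in> cf_interval (Suc n) b" for z b n
    using that by auto
  have mem: "y n \<in> cf_interval m (\<lambda>i. a (n + i))" for n m
  proof (induction n arbitrary: m)
    case 0
    then show ?case using x by (simp add: y0)
  next
    case (Suc n)
    from step[OF Suc.IH[of "Suc m"]] show ?case by (simp add: ys)
  qed
  have y01: "0 \<le> y n" "y n \<le> 1" for n using mem[of n 0] by auto
  have rec: "y n = 1 / (real (a n) + y (Suc n))" for n
  proof -
    obtain z where "y n = 1 / (real (a n) + z)" using mem[of n "Suc 0"] by auto
    then show ?thesis by (simp add: ys)
  qed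
  have pos: "0 < y n" for n
  proof -
    have "0 < real (a n) + y (Suc n)" using a y01[of "Suc n"] by (simp add: add_pos_nonneg)
    then show ?thesis by (subst rec) simp
  qed
  have "y n < 1" for n
  proof -
    have "1 \<le> real (a n)" using a by (metis Suc_leI of_nat_1 of_nat_le_iff One_nat_def)
    then have "1 < real (a n) + y (Suc n)" using pos[of "Suc n"] by linarith
    then show ?thesis by (subst rec) simp
  qed
  then show ?thesis using pos by (intro that[of y]) (auto simp: ys)
qed

text \<open>The orbit stays strictly between 0 and 1, so \<open>a n\<close> is the floor of 1 / y n
  and \<open>cf_digit\<close> is in its infinite case throughout.\<close>

lemma cf_number_exists:
  fixes a :: "nat \<Rightarrow> nat"
  assumes a: "\<forall>i. 0 < a i"
  obtains x where "0 \<le> x" "x < 1" "\<And>i. cf_digit x (i + 1) = a i"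
proof -
  obtain y where y: "\<And>n. 0 < y n" "\<And>n. y n < 1" "\<And>n. 1 / y n = real (a n) + y (Suc n)"
    using cf_orbit_exists[OF a] by blast
  have fl: "\<lfloor>1 / y n\<rfloor> = int (a n)" for n
    unfolding y(3) using y(1,2)[of "Suc n"] by (intro floor_unique) auto
  have g: "gauss_map (y n) = y (Suc n)" for n
  proof -
    have "gauss_map (y n) = 1 / y n - of_int \<lfloor>1 / y n\<rfloor>"
      using y(1)[of n] by (simp add: gauss_map_def frac_def)
    then show ?thesis unfolding fl using y(3)[of n] by simp
  qed
  have it: "(gauss_map ^^ n) (y 0) = y n" for n by (induction n) (simp_all add: g)
  show ?thesis
  proof (rule that[of "y 0"])
    fix i
    have "gauss_map (y i) \<noteq> 0" "y i \<noteq> 0" using y(1)[of i] y(1)[of "Suc i"] by (auto simp: g)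
    then show "cf_digit (y 0) (i + 1) = a i" by (simp add: cf_digit_def it fl)
  qed (use y(1,2)[of 0] in auto)
qed

section \<open>Cylinders as intervals, up to rationals\<close>

definition cf_between :: "nat list \<Rightarrow> real set" where
  "cf_between s = {min (cf_val s 0) (cf_val s 1)<..<max (cf_val s 0) (cf_val s 1)}"

lemma gauss_map_irrational:
  assumes "x \<notin> \<rat>"
  shows "gauss_map x \<notin> \<rat>"
proof
  assume "gauss_map x \<in> \<rat>"
  moreover have "x \<noteq> 0" using assms by auto
  ultimately have "1 / x - of_int \<lfloor>1 / x\<rfloor> \<in> \<rat>" by (simp add: gauss_map_def frac_def)
  then have "(1 / x - of_int \<lfloor>1 / x\<rfloor>) + of_int \<lfloor>1 / x\<rfloor> \<in> \<rat>" by (intro Rats_add) auto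
  then have "1 / x \<in> \<rat>" by simp
  then have "1 / (1 / x) \<in> \<rat>" by (rule Rats_divide[OF Rats_1])
  then show False using assms by simp
qed

text \<open>No iterate of an irrational number is 0, so digits are plain floors and shift with the
  Gauss map.\<close>

lemma cf_digit_irrational:
  assumes "x \<notin> \<rat>"
  shows "cf_digit x (Suc 0) = nat \<lfloor>1 / x\<rfloor>"
    and "cf_digit x (Suc (Suc n)) = cf_digit (gauss_map x) (Suc n)"
proof -
  have it: "(gauss_map ^^ n) x \<notin> \<rat>" for n
    by (induction n) (use assms gauss_map_irrational in auto)
  then have nz: "(gauss_map ^^ n) x \<noteq> 0" for n by (metis Rats_0)
  from nz[of 0] nz[of 1] show "cf_digit x (Suc 0) = nat \<lfloor>1 / x\<rfloor>" by (simp add: cf_digit_def)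
  have sh: "(gauss_map ^^ n) (gauss_map x) = (gauss_map ^^ Suc n) x" for n by (simp add: funpow_swap1)
  have "gauss_map ((gauss_map ^^ Suc n) x) \<noteq> 0" for n using nz[of "Suc (Suc n)"] by simp
  then show "cf_digit x (Suc (Suc n)) = cf_digit (gauss_map x) (Suc n)"
    unfolding cf_digit_def sh using nz[of "Suc n"] sh[of n] by (simp del: funpow.simps)
qed

text \<open>The first digit is \<open>a\<close> exactly when y = 1 / x - a lies in the open unit
  interval, and then y is the image of x under the Gauss map. The branch 1 / (a + y) is decreasing,
  so it exchanges minimum and maximum of the end points.\<close>

lemma irrational_cylinder_iff:
  assumes "x \<notin> \<rat>" "\<forall>k\<in>set s. 0 < k"
  shows "x \<in> cylinder s \<longleftrightarrow> x \<in> cf_between s"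
  using assms
proof (induction s arbitrary: x)
  case Nil
  have "x \<noteq> 0" "x \<noteq> 1" using Nil by auto
  then show ?case by (auto simp: cylinder_def cf_between_def)
next
  case (Cons a s)
  have x0: "x \<noteq> 0" using Cons.prems by auto
  have a: "0 < a" using Cons.prems by simp
  have v: "cf_val s 0 \<in> {0..1}" "cf_val s 1 \<in> {0..1}"
    using Cons.prems cf_val_mem[of 0 s] cf_val_mem[of 1 s] by auto
  define y where "y = 1 / x - real a"
  have yQ: "y \<notin> \<rat>"
  proof
    assume "y \<in> \<rat>"
    then have "1 / (y + real a) \<in> \<rat>" by (intro Rats_divide Rats_add) auto
    then show False using Cons.prems by (simp add: y_def)
  qed
  have xy: "x = 1 / (real a + y)" using x0 by (simp add: y_def)
  have "x \<in> cylinder (a # s) \<longleftrightarrow> 0 \<le> x \<and> x < 1 \<and> nat \<lfloor>1 / x\<rfloor> = a \<and> gauss_map x \<in> cylinder s"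
  proof -
    have "(\<forall>i<length (a # s). cf_digit x (i + 1) = (a # s) ! i) \<longleftrightarrow>
        cf_digit x 1 = a \<and> (\<forall>i<length s. cf_digit x (Suc (Suc i)) = s ! i)"
      by (auto simp: nth_Cons less_Suc_eq_0_disj)
    moreover have "0 \<le> gauss_map x" "gauss_map x < 1" using x0 by (auto simp: gauss_map_def frac_lt_1)
    ultimately show ?thesis using cf_digit_irrational[OF Cons.prems(1)]
      by (auto simp: cylinder_def)
  qed
  also have "\<dots> \<longleftrightarrow> 0 < y \<and> y < 1 \<and> y \<in> cylinder s"
  proof
    assume L: "0 \<le> x \<and> x < 1 \<and> nat \<lfloor>1 / x\<rfloor> = a \<and> gauss_map x \<in> cylinder s"
    then have "\<lfloor>1 / x\<rfloor> = int a" using a by linarith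
    then have "gauss_map x = y" using x0 by (simp add: gauss_map_def frac_def y_def)
    moreover have "y \<noteq> 0" "y \<noteq> 1" using yQ by auto
    ultimately show "0 < y \<and> y < 1 \<and> y \<in> cylinder s" using L by (auto simp: cylinder_def)
  next
    assume R: "0 < y \<and> y < 1 \<and> y \<in> cylinder s"
    have fl: "\<lfloor>1 / x\<rfloor> = int a" using R by (intro floor_unique) (auto simp: y_def)
    then have "gauss_map x = y" using x0 by (simp add: gauss_map_def frac_def y_def)
    moreover have "1 < real a + y" using R a by linarith
    ultimately show "0 \<le> x \<and> x < 1 \<and> nat \<lfloor>1 / x\<rfloor> = a \<and> gauss_map x \<in> cylinder s"
      using R fl by (subst (1 2) xy) auto
  qed
  also have "\<dots> \<longleftrightarrow> 0 < y \<and> y < 1 \<and> y \<in> cf_between s" using Cons.IH[OF yQ] Cons.prems by auto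
  also have "\<dots> \<longleftrightarrow> y \<in> cf_between s" using v by (auto simp: cf_between_def)
  also have "\<dots> \<longleftrightarrow> x \<in> cf_between (a # s)"
  proof -
    have inv: "1 / (real a + c) < 1 / (real a + d) \<longleftrightarrow> d < c" if "0 < real a + c" "0 < real a + d" for c d
      using that by (simp add: field_simps)
    have inv_le: "1 / (real a + c) \<le> 1 / (real a + d) \<longleftrightarrow> d \<le> c" if "0 < real a + c" "0 < real a + d" for c d
      using inv[OF that(2,1)] by (simp only: not_less[symmetric])
    have mm: "min (1 / (real a + c)) (1 / (real a + d)) = 1 / (real a + max c d)"
      "max (1 / (real a + c)) (1 / (real a + d)) = 1 / (real a + min c d)" if "0 \<le> c" "0 \<le> d" for c d
      using that a by (simp_all add: min_def max_def inv_le add_pos_nonneg)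
    have pos: "0 < real a + max (cf_val s 0) (cf_val s 1)" "0 < real a + min (cf_val s 0) (cf_val s 1)"
      using v a by (auto simp: max_def min_def)
    have "x \<in> cf_between (a # s) \<longleftrightarrow> 1 / (real a + max (cf_val s 0) (cf_val s 1)) < x \<and>
        x < 1 / (real a + min (cf_val s 0) (cf_val s 1))"
      unfolding cf_between_def using v by (simp add: mm)
    also have "\<dots> \<longleftrightarrow> y \<in> cf_between s"
    proof (cases "0 < real a + y")
      case True
      then show ?thesis unfolding xy cf_between_def using pos by (auto simp: inv)
    next
      \<comment> \<open>Here 1 / x = a + y is not positive: x lies to the left of the interval and y
        outside the unit interval, so both sides are false.\<close>
      case False
      then have "x \<le> 0" unfolding xy by (simp add: divide_le_0_iff)
      moreover have "0 < 1 / (real a + max (cf_val s 0) (cf_val s 1))" using pos by simp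
      moreover have "y \<notin> cf_between s" using False v a by (auto simp: cf_between_def min_def max_def split: if_splits)
      ultimately show ?thesis by linarith
    qed
    finally show ?thesis by simp
  qed
  finally show ?case .
qed

text \<open>Each digit applies a decreasing map. The parity decides which end point is the smaller
  one and so matches the sign in \<open>word_freq\<close>.\<close>

lemma cf_val_alternating:
  assumes "\<forall>k\<in>set s. 0 < k"
  shows "0 < (-1) ^ length s * (cf_val s 1 - cf_val s 0)"
  using assms
proof (induction s)
  case (Cons a s)
  have v: "0 \<le> cf_val s 0" "0 \<le> cf_val s 1"
    using Cons.prems cf_val_mem[of 0 s] cf_val_mem[of 1 s] by auto
  have a: "0 < real a + cf_val s 0" "0 < real a + cf_val s 1" using Cons.prems v by (auto simp: add_pos_nonneg)
  have "cf_val (a # s) 1 - cf_val (a # s) 0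
     = (cf_val s 0 - cf_val s 1) / ((real a + cf_val s 0) * (real a + cf_val s 1))"
    using a by (simp add: field_simps)
  then have "(-1) ^ length (a # s) * (cf_val (a # s) 1 - cf_val (a # s) 0)
     = (-1) ^ Suc (length s) * ((cf_val s 0 - cf_val s 1) / ((real a + cf_val s 0) * (real a + cf_val s 1)))"
    by (simp only: length_Cons)
  also have "\<dots> = (-1) ^ length s * (- (cf_val s 0 - cf_val s 1)) / ((real a + cf_val s 0) * (real a + cf_val s 1))"
    by (simp del: minus_diff_eq)
  also have "- (cf_val s 0 - cf_val s 1) = cf_val s 1 - cf_val s 0" by simp
  finally have "(-1) ^ length (a # s) * (cf_val (a # s) 1 - cf_val (a # s) 0)
     = (-1) ^ length s * (cf_val s 1 - cf_val s 0) / ((real a + cf_val s 0) * (real a + cf_val s 1))" .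
  then show ?case using Cons a by simp
qed simp

text \<open>The cylinder and an interval differ only in rationals, a null set that absorbs the
  convention for finite expansions.\<close>

lemma gauss_measure_cylinder:
  assumes s: "\<forall>k\<in>set s. 0 < k"
  shows "gauss_measure (cylinder s) = word_freq s"
proof -
  define l where "l = min (cf_val s 0) (cf_val s 1)"
  define u where "u = max (cf_val s 0) (cf_val s 1)"
  have v: "0 \<le> l" "l \<le> u"
    using s cf_val_mem[of 0 s] cf_val_mem[of 1 s] by (auto simp: l_def u_def)
  have cnt: "countable (\<rat> :: real set)" by (rule countable_rat)
  have null: "A \<in> null_sets lborel" if "A \<subseteq> \<rat>" for A :: "real set"
    using countable_subset[OF that cnt] by (rule countable_imp_null_set_lborel)
  have iff: "x \<in> cylinder s \<longleftrightarrow> x \<in> {l<..<u}" if "x \<notin> \<rat>" for x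
    using irrational_cylinder_iff[OF that s] by (simp add: cf_between_def l_def u_def)
  have meas: "cylinder s \<in> sets lborel"
  proof -
    have "cylinder s = (cylinder s \<inter> \<rat>) \<union> ({l<..<u} - \<rat>)"
      using iff by blast
    moreover have "cylinder s \<inter> \<rat> \<in> sets lborel" using null[of "cylinder s \<inter> \<rat>"] by auto
    moreover have "{l<..<u} - \<rat> \<in> sets lborel" using null[of \<rat>] by auto
    ultimately show ?thesis by (metis sets.Un)
  qed
  have ae: "AE x in lborel. x \<notin> (\<rat> :: real set)" using null[of \<rat>] by (simp add: AE_not_in)
  have "(LINT x:cylinder s|lborel. 1 / (1 + x)) = (LINT x:{l..u}|lborel. 1 / (1 + x))"
    unfolding set_lebesgue_integral_def
  proof (intro integral_cong_AE)
    show "AE x in lborel. indicat_real (cylinder s) x *\<^sub>R (1 / (1 + x)) = indicat_real {l..u} x *\<^sub>R (1 / (1 + x))"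
      using ae AE_lborel_singleton[of l] AE_lborel_singleton[of u]
    proof eventually_elim
      case (elim x)
      then have "x \<in> cylinder s \<longleftrightarrow> x \<in> {l..u}"
        using iff[of x] by auto
      then show ?case by (simp add: indicator_def)
    qed
  qed (use meas in measurable)
  also have "\<dots> = ln (1 + u) - ln (1 + l)"
  proof -
    have "((\<lambda>x. 1 / (1 + x)) has_integral (ln (1 + u) - ln (1 + l))) {l..u}"
      using v by (intro fundamental_theorem_of_calculus)
       (auto intro!: derivative_eq_intros simp flip: has_real_derivative_iff_has_vector_derivative)
    moreover have "set_integrable lborel {l..u} (\<lambda>x. 1 / (1 + x))"
      using v by (intro borel_integrable_atLeastAtMost') (auto intro!: continuous_intros)
    ultimately show ?thesis by (simp add: set_borel_integral_eq_integral(2) integral_unique)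
  qed
  also have "\<dots> = (-1) ^ length s * (ln (1 + cf_val s 1) - ln (1 + cf_val s 0))"
    using cf_val_alternating[OF s] by (cases "even (length s)") (auto simp: l_def u_def)
  finally show ?thesis by (simp add: gauss_measure_def word_freq_def)
qed

section \<open>Chebyshev's lower bound\<close>

text \<open>The Leibniz harmonic triangle identity
  \<open>1 / ((n+2) C(n+1, k+1)) = 1 / ((n+1) C(n, k)) - 1 / ((n+2) C(n+1, k))\<close>
  gives \<open>Lcm {1..n+1} \<ge> 2 ^ n\<close>.\<close>

lemma Suc_times_binomial_dvd_Lcm:
  "k \<le> n \<Longrightarrow> Suc n * (n choose k) dvd Lcm {1..Suc n}"
proof (induction k arbitrary: n)
  case 0
  then show ?case by (simp add: dvd_Lcm)
next
  case (Suc k)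
  obtain m where m: "n = Suc m" using Suc.prems by (cases n) auto
  have km: "k \<le> m" using Suc.prems m by simp
  define M :: nat where "M = Lcm {1..Suc n}"
  define A where "A = Suc m * (m choose k)"
  define B where "B = Suc (Suc m) * (Suc m choose k)"
  define C where "C = Suc (Suc m) * (Suc m choose Suc k)"
  have "Lcm {1..Suc m} dvd M" unfolding M_def m by (rule Lcm_subset) auto
  with Suc.IH[OF km] have "A dvd M" unfolding A_def by (rule dvd_trans)
  then obtain a where a: "M = A * a" by auto
  have "B dvd M" unfolding B_def M_def m using Suc.IH[of "Suc m"] km by simp
  then obtain b where b: "M = B * b" by auto
  have pos: "0 < A" "0 < B" "0 < C" using km Suc.prems m
    by (simp_all add: A_def B_def C_def)
  have bc: "(Suc m choose Suc k) * Suc k = Suc m * (m choose k)"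
    by (metis Suc_times_binomial_eq mult.commute)
  have bb: "(Suc m choose k) * (Suc m - k) = Suc m * (m choose k)"
    using binomial_absorb_comp[of "Suc m" k] km by (simp add: mult.commute)
  have kB: "B * (Suc m - k) = Suc (Suc m) * A"
    unfolding A_def B_def by (metis bb mult.assoc)
  have kC: "C * Suc k = Suc (Suc m) * A"
    unfolding A_def C_def by (metis bc mult.assoc)
  define x where "x = Suc m - k"
  have xk: "real x + real (Suc k) = real (Suc (Suc m))" using km by (simp add: x_def)
  have r: "1 / real C = 1 / real A - 1 / real B"
  proof -
    have 1: "1 / real B = real x / (real (Suc (Suc m)) * real A)"
    proof -
      have "real B * real x = real (Suc (Suc m)) * real A"
        using kB unfolding x_def by (metis of_nat_mult)
      then show ?thesis using pos by (simp add: field_simps del: of_nat_Suc)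
    qed
    have 2: "1 / real C = real (Suc k) / (real (Suc (Suc m)) * real A)"
    proof -
      have "real C * real (Suc k) = real (Suc (Suc m)) * real A"
        using kC by (metis of_nat_mult)
      then show ?thesis using pos by (simp add: field_simps del: of_nat_Suc)
    qed
    have "1 / real B + 1 / real C = (real x + real (Suc k)) / (real (Suc (Suc m)) * real A)"
      unfolding 1 2 by (simp add: add_divide_distrib)
    also have "\<dots> = 1 / real A" unfolding xk by simp
    finally show ?thesis by simp
  qed
  \<comment> \<open>Both quotients on the right are integers, by the induction hypothesis for
    \<open>m\<close> and for \<open>Suc m\<close>; hence so is M / C, that is, \<open>C\<close>
    divides \<open>M\<close>.\<close>
  have "real M / real C = real M / real A - real M / real B"
    using arg_cong[OF r, of "\<lambda>z. real M * z"] by (simp add: algebra_simps)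
  also have "real M / real A = real a" using a pos by (simp add: field_simps)
  also have "real M / real B = real b" using b pos by (simp add: field_simps)
  finally have "real M = (real a - real b) * real C" using pos by (simp add: field_simps)
  then have "real_of_int (int M) = real_of_int ((int a - int b) * int C)" by simp
  then have "int M = (int a - int b) * int C" by (rule of_int_eq_iff[THEN iffD1])
  then have "int C dvd int M" by simp
  then show ?case unfolding C_def M_def m by (simp only: int_dvd_int_iff)
qed

text \<open>The n + 1 numbers (n + 1) C(n, k) all divide the least common multiple, and their sum is
  (n + 1) 2^n.\<close>

lemma two_power_le_Lcm: "2 ^ n \<le> Lcm {1..Suc n}"
proof -
  have L0: "0 < Lcm {1..Suc n}" by (simp add: Lcm_0_iff neq0_conv[symmetric] del: neq0_conv)
  have "Suc n * 2 ^ n = (\<Sum>k\<le>n. Suc n * (n choose k))"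
    by (simp only: choose_row_sum[symmetric] sum_distrib_left)
  also have "\<dots> \<le> (\<Sum>k\<le>n. Lcm {1..Suc n})"
    by (intro sum_mono dvd_imp_le[OF Suc_times_binomial_dvd_Lcm L0]) auto
  also have "\<dots> = Suc n * Lcm {1..Suc n}" by simp
  finally show ?thesis by (metis Suc_mult_le_cancel1)
qed

text \<open>A prime enters the least common multiple with its largest power not exceeding
  \<open>m\<close>, which is a factor of at most \<open>m\<close>.\<close>

lemma Lcm_le_power_prime_count:
  fixes m :: nat
  assumes "0 < m"
  shows "Lcm {1..m} \<le> m ^ card {p. prime p \<and> p \<le> m}"
proof -
  define P where "P = {p. prime p \<and> p \<le> m}"
  have fin: "finite P" by (rule finite_subset[of _ "{..m}"]) (auto simp: P_def)
  define e where "e p = Max {k. p ^ k \<le> m}" for p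
  have fe: "finite {k. p ^ k \<le> m}" if "prime p" for p
  proof (rule finite_subset)
    show "{k. p ^ k \<le> m} \<subseteq> {..m}"
    proof safe
      fix k assume "p ^ k \<le> m"
      moreover have "k < p ^ k" using prime_gt_Suc_0_nat[OF that] by (rule power_gt_expt)
      ultimately show "k \<le> m" by simp
    qed
  qed simp
  have e1: "p ^ e p \<le> m" if "prime p" for p
  proof -
    have "e p \<in> {k. p ^ k \<le> m}" unfolding e_def
      by (rule Max_in[OF fe[OF that]]) (use assms in \<open>auto intro: exI[of _ 0]\<close>)
    then show ?thesis by simp
  qed
  have e2: "k \<le> e p" if "prime p" "p ^ k \<le> m" for p k
    unfolding e_def using that fe by (intro Max_ge) auto
  have "Lcm {1..m} dvd (\<Prod>p\<in>P. p ^ e p)"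
  proof (rule Lcm_least)
    fix j assume j: "j \<in> {1..m}"
    then have "j = (\<Prod>p\<in>prime_factors j. p ^ multiplicity p j)"
      by (subst prod_prime_factors) auto
    also have "\<dots> dvd (\<Prod>p\<in>prime_factors j. p ^ e p)"
    proof (intro prod_dvd_prod le_imp_power_dvd e2)
      fix p assume p: "p \<in> prime_factors j"
      then show "prime p" by auto
      show "p ^ multiplicity p j \<le> m"
        using dvd_imp_le[OF multiplicity_dvd[of p j]] j by auto
    qed
    also have "\<dots> dvd (\<Prod>p\<in>P. p ^ e p)"
    proof (rule prod_dvd_prod_subset[OF fin])
      show "prime_factors j \<subseteq> P"
      proof
        fix p assume p: "p \<in> prime_factors j"
        then have "p \<le> j" using j by (auto intro!: dvd_imp_le)
        with p j show "p \<in> P" by (auto simp: P_def)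
      qed
    qed
    finally show "j dvd (\<Prod>p\<in>P. p ^ e p)" .
  qed
  moreover have "0 < (\<Prod>p\<in>P. p ^ e p)"
    by (intro prod_pos) (auto simp: P_def prime_gt_0_nat)
  ultimately have "Lcm {1..m} \<le> (\<Prod>p\<in>P. p ^ e p)" by (rule dvd_imp_le)
  also have "\<dots> \<le> (\<Prod>p\<in>P. m)" by (intro prod_mono) (auto simp: P_def e1)
  finally show ?thesis by (simp add: P_def)
qed

theorem chebyshev_lower_bound:
  "real n * ln 2 \<le> real (card {p. prime p \<and> p \<le> Suc n}) * ln (real (Suc n))"
proof -
  let ?c = "card {p. prime p \<and> p \<le> Suc n}"
  have "2 ^ n \<le> Suc n ^ ?c"
    using two_power_le_Lcm[of n] Lcm_le_power_prime_count[of "Suc n"] by linarith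
  then have "real (2 ^ n) \<le> real (Suc n ^ ?c)" by (rule of_nat_mono)
  then have "(2::real) ^ n \<le> real (Suc n) ^ ?c" by (simp only: of_nat_power of_nat_numeral)
  then have "ln ((2::real) ^ n) \<le> ln (real (Suc n) ^ ?c)" by (intro ln_mono) auto
  then show ?thesis by (simp add: ln_realpow)
qed

text \<open>The square of the set of primes consists of two triangles of equal size and the
  diagonal.\<close>

lemma prime_pairs_count:
  fixes Q :: nat
  shows "card {(p, q). prime p \<and> prime q \<and> p < q \<and> q < Q} * 2
       = card {p. prime p \<and> p < Q} * (card {p. prime p \<and> p < Q} - 1)"
proof -
  define P where "P = {p::nat. prime p \<and> p < Q}"
  have fin: "finite P" by (rule finite_subset[of _ "{..Q}"]) (auto simp: P_def)
  let ?A = "{(p, q). prime p \<and> prime q \<and> p < q \<and> q < Q}"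
  let ?B = "{(q, p). prime p \<and> prime q \<and> p < q \<and> q < Q}"
  have fA: "finite ?A" by (rule finite_subset[of _ "{..Q} \<times> {..Q}"]) auto
  have fB: "finite ?B" by (rule finite_subset[of _ "{..Q} \<times> {..Q}"]) auto
  have AB: "card ?A = card ?B"
    by (rule bij_betw_same_card[of prod.swap]) (auto simp: bij_betw_def inj_on_def image_iff)
  have PP: "P \<times> P = ?A \<union> ?B \<union> (\<lambda>p. (p, p)) ` P" by (auto simp: P_def)
  have "card (?A \<union> ?B \<union> (\<lambda>p. (p, p)) ` P) = card (?A \<union> ?B) + card ((\<lambda>p. (p, p)) ` P)"
    using fA fB fin by (intro card_Un_disjoint) auto
  moreover have "card (?A \<union> ?B) = card ?A + card ?B"
    using fA fB by (intro card_Un_disjoint) auto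
  moreover have "card ((\<lambda>p. (p, p)) ` P) = card P" by (rule card_image) (auto simp: inj_on_def)
  ultimately have "card P * card P = card ?A + card ?A + card P"
    using AB card_cartesian_product[of P P] unfolding PP by linarith
  then have "card ?A * 2 = card P * card P - card P" by simp
  then show ?thesis unfolding P_def[symmetric] by (simp add: diff_mult_distrib2)
qed

section \<open>The concatenated word\<close>

definition farey :: "nat \<Rightarrow> (nat \<times> nat) set" where
  "farey Q = {(p, q). 0 < p \<and> p < q \<and> q \<le> Q \<and> coprime p q}"

abbreviation cf_word :: "nat \<times> nat \<Rightarrow> nat list" where
  "cf_word \<equiv> \<lambda>(p, q). cf_long p q"

lemma finite_farey: "finite (farey Q)"
  by (rule finite_subset[of _ "{..Q} \<times> {..Q}"]) (auto simp: farey_def)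

lemma cf_word_farey:
  assumes "z \<in> farey Q"
  shows "\<forall>k\<in>set (cf_word z). 0 < k" "cf_den (cf_word z) \<le> Q"
    "(cf_num (cf_word z), cf_den (cf_word z)) = z"
proof -
  obtain p q where z: "z = (p, q)" by (cases z)
  with assms have "0 < p" "p < q" "coprime p q" "q \<le> Q" by (auto simp: farey_def)
  with cf_long_properties[of p q]
  show "\<forall>k\<in>set (cf_word z). 0 < k" "cf_den (cf_word z) \<le> Q"
    "(cf_num (cf_word z), cf_den (cf_word z)) = z" by (simp_all add: z)
qed

lemma inj_on_cf_word: "inj_on cf_word (farey Q)"
  by (rule inj_on_inverseI[where g="\<lambda>w. (cf_num w, cf_den w)"]) (rule cf_word_farey(3))

lemma length_cf_word_le:
  assumes "z \<in> farey Q"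
  shows "real (length (cf_word z)) \<le> 2 * log 2 (real Q) + 1"
proof -
  have "2 ^ (length (cf_word z) div 2) \<le> Q"
    using two_power_le_cf_den cf_word_farey[OF assms] by (meson order_trans)
  then have "(2::real) ^ (length (cf_word z) div 2) \<le> real Q"
    by (metis of_nat_le_iff of_nat_numeral of_nat_power)
  then have "2 powr real (length (cf_word z) div 2) \<le> real Q" by (simp add: powr_realpow)
  moreover have "0 < real Q" using assms by (auto simp: farey_def)
  ultimately have "real (length (cf_word z) div 2) \<le> log 2 (real Q)" by (simp add: le_log_iff)
  moreover have "length (cf_word z) \<le> 2 * (length (cf_word z) div 2) + 1" by linarith
  then have "real (length (cf_word z)) \<le> 2 * real (length (cf_word z) div 2) + 1" by linarith
  ultimately show ?thesis by linarith
qed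

text \<open>Short expansions count as bad for two reasons: the deviation estimate is too weak for
  them, and each junction in the concatenation costs \<open>length s\<close>, which is negligible
  only against a long word.\<close>

definition bad_rationals :: "nat list \<Rightarrow> real \<Rightarrow> real \<Rightarrow> nat \<Rightarrow> (nat \<times> nat) set" where
  "bad_rationals s \<epsilon> c Q = {z \<in> farey Q. real (length (cf_word z)) < c * ln (real Q) \<or>
     \<epsilon> * real (length (cf_word z)) < \<bar>deviation s (cf_word z)\<bar>}"

text \<open>Words are counted length by length; at most 2 log2 Q + 2 lengths occur, whence the
  logarithmic factor.\<close>

proposition card_bad_rationals:
  assumes s: "s \<noteq> []" "\<forall>k\<in>set s. 0 < k" and \<epsilon>: "0 < \<epsilon>" "\<epsilon> \<le> 1"
  obtains c \<eta> where "0 < c" "0 < \<eta>" "\<eta> < 1"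
    "\<And>Q. 2 \<le> Q \<Longrightarrow> real (card (bad_rationals s \<epsilon> c Q)) \<le> 12 * (2 * log 2 (real Q) + 2) * real Q powr (2 - \<eta>)"
proof -
  obtain \<delta> where \<delta>: "0 < \<delta>" "\<And>n t. t \<in> {0..1} \<Longrightarrow>
      measure_pmf.prob (word_pmf n t) {w. \<epsilon> * real n < \<bar>deviation s w\<bar>} \<le> 6 * exp (- \<delta> * real n)"
    using large_deviation[OF s \<epsilon>] by blast
  obtain B where B: "3 \<le> B"
    "\<And>t. t \<in> {0..1} \<Longrightarrow> (\<integral>\<^sup>+k. ennreal (sqrt (real (Suc k))) \<partial>digit_pmf t) \<le> ennreal B"
    using digit_sqrt_moment by blast
  have lnB: "0 < ln B" using B(1) by simp
  \<comment> \<open>Then n < c ln Q gives B^n <= Q^(1/4), so the bound 2 Q^(3/2) B^n for short words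
    is at most 2 Q^(2 - 1/4); for other lengths exp (- \<delta> n) <= Q^(- \<delta> c). The exponent
    \<open>\<eta>\<close> is the smaller of the two savings.\<close>
  define c where "c = 1 / (4 * ln B)"
  have c: "0 < c" using lnB by (simp add: c_def)
  define \<eta> where "\<eta> = min (1/4) (\<delta> * c)"
  have "real (card (bad_rationals s \<epsilon> c Q)) \<le> 12 * (2 * log 2 (real Q) + 2) * real Q powr (2 - \<eta>)"
    if Q2: "2 \<le> Q" for Q
  proof -
    let ?bad = "bad_rationals s \<epsilon> c Q"
    define W where "W n = {w \<in> cf_word ` ?bad. length w = n}" for n
    define N where "N = nat \<lfloor>2 * log 2 (real Q) + 1\<rfloor>"
    have Q1: "1 \<le> real Q" "0 < real Q" using Q2 by auto
    have bf: "?bad \<subseteq> farey Q" by (auto simp: bad_rationals_def)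
    then have fin: "finite ?bad" using finite_farey finite_subset by blast
    have fW: "finite (W n)" for n unfolding W_def using fin by simp
    have W: "length w = n \<and> (\<forall>k\<in>set w. 0 < k) \<and> real (cf_den w) \<le> real Q" if wn: "w \<in> W n" for w n
    proof -
      obtain z where z: "z \<in> ?bad" "w = cf_word z" "length w = n" using wn unfolding W_def by blast
      then have "z \<in> farey Q" using bf by blast
      from cf_word_farey(1,2)[OF this] z show ?thesis by simp
    qed
    have card_W: "real (card (W n)) \<le> 12 * real Q powr (2 - \<eta>)" for n
    proof (cases "real n < c * ln (real Q)")
      case True
      have "real (card (W n)) \<le> 2 * (real Q * sqrt (real Q)) * B ^ n"
        using Q1 B by (intro card_words_le_sqrt_moment fW W) auto
      also have "B ^ n \<le> real Q powr (1/4)"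
      proof -
        have "B ^ n = exp (real n * ln B)" using B(1) by (simp add: exp_of_nat_mult)
        also have "real n * ln B \<le> (c * ln (real Q)) * ln B" using True lnB by (intro mult_right_mono) auto
        also have "\<dots> = 1/4 * ln (real Q)" using lnB by (simp add: c_def)
        finally show ?thesis using Q1 by (simp add: powr_def)
      qed
      also have "2 * (real Q * sqrt (real Q)) * real Q powr (1/4) = 2 * (real Q powr (7/4))"
      proof -
        have "real Q powr (7/4) = real Q powr (1 + 1/2 + 1/4)" by simp
        also have "\<dots> = real Q * sqrt (real Q) * real Q powr (1/4)"
          unfolding powr_add using Q1 by (simp add: powr_half_sqrt)
        finally show ?thesis by simp
      qed
      also have "\<dots> \<le> 12 * real Q powr (2 - \<eta>)"
        using Q1 by (intro mult_mono powr_mono) (auto simp: \<eta>_def)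
      finally show ?thesis using Q1 by (simp add: mult_left_mono)
    next
      case False
      have sub: "W n \<subseteq> {w. \<epsilon> * real n < \<bar>deviation s w\<bar>}"
        using False unfolding W_def bad_rationals_def by fastforce
      have "real (card (W n)) \<le> 2 * (real Q)\<^sup>2 * measure_pmf.prob (word_pmf n 0) (W n)"
        using Q1 by (intro card_words_le_prob fW W) auto
      also have "measure_pmf.prob (word_pmf n 0) (W n) \<le> measure_pmf.prob (word_pmf n 0) {w. \<epsilon> * real n < \<bar>deviation s w\<bar>}"
        by (intro measure_pmf.finite_measure_mono sub) auto
      also have "\<dots> \<le> 6 * exp (- \<delta> * real n)" by (intro \<delta>) auto
      also have "exp (- \<delta> * real n) \<le> real Q powr (- (\<delta> * c))"
      proof -
        have "\<delta> * (c * ln (real Q)) \<le> \<delta> * real n" using False \<delta>(1) by (intro mult_left_mono) auto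
        then show ?thesis using Q1 by (simp add: powr_def mult_ac)
      qed
      also have "2 * (real Q)\<^sup>2 * (6 * real Q powr (- (\<delta> * c))) = 12 * real Q powr (2 - \<delta> * c)"
        using Q1 by (simp add: powr_diff powr_minus divide_inverse)
      also have "\<dots> \<le> 12 * real Q powr (2 - \<eta>)"
        using Q1 by (intro mult_left_mono powr_mono) (auto simp: \<eta>_def)
      finally show ?thesis using Q1 by (simp add: mult_left_mono)
    qed
    have "cf_word ` ?bad = (\<Union>n\<in>{..N}. W n)"
    proof (intro equalityI subsetI)
      fix w assume w: "w \<in> cf_word ` ?bad"
      then obtain z where z: "z \<in> farey Q" "w = cf_word z" using bf by blast
      then have "int (length w) \<le> \<lfloor>2 * log 2 (real Q) + 1\<rfloor>"
        using length_cf_word_le[OF z(1)] by (simp only: le_floor_iff of_int_of_nat_eq)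
      then have "length w \<le> N" by (simp add: N_def)
      then show "w \<in> (\<Union>n\<in>{..N}. W n)" using w by (auto simp: W_def)
    qed (auto simp: W_def)
    then have "card (cf_word ` ?bad) \<le> (\<Sum>n\<in>{..N}. card (W n))" by (simp add: card_UN_le)
    moreover have "card (cf_word ` ?bad) = card ?bad"
      by (intro card_image inj_on_subset[OF inj_on_cf_word bf])
    ultimately have "real (card ?bad) \<le> (\<Sum>n\<in>{..N}. real (card (W n)))"
      by (metis of_nat_le_iff of_nat_sum)
    also have "\<dots> \<le> (\<Sum>n\<in>{..N}. 12 * real Q powr (2 - \<eta>))" by (intro sum_mono card_W)
    also have "\<dots> = (real N + 1) * (12 * real Q powr (2 - \<eta>))" by simp
    also have "\<dots> \<le> (2 * log 2 (real Q) + 2) * (12 * real Q powr (2 - \<eta>))"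
    proof (intro mult_right_mono)
      have "0 \<le> log 2 (real Q)" using Q1 by simp
      then show "real N + 1 \<le> 2 * log 2 (real Q) + 2" unfolding N_def by linarith
    qed simp
    finally show ?thesis by (simp only: mult_ac)
  qed
  moreover have "0 < \<eta>" "\<eta> < 1" using \<delta>(1) c by (auto simp: \<eta>_def)
  ultimately show ?thesis using c that by blast
qed

section \<open>The order of concatenation and the length of prefixes\<close>

definition selected :: "(nat \<Rightarrow> nat \<Rightarrow> bool) \<Rightarrow> nat \<Rightarrow> (nat \<times> nat) list" where
  "selected sel Q = concat (map (sel_with_denom sel) [2..<Q])"

lemma concat_word_eq: "concat_word sel Q = concat (map cf_word (selected sel Q))"
  by (simp add: concat_word_def selected_def)

lemma sel_with_denom_eq:
  "sel_with_denom sel q = map (\<lambda>p. (p, q)) (filter (\<lambda>p. coprime p q \<and> sel p q) [1..<q])"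
proof -
  have "concat (map (\<lambda>p. if P p then [(p, q)] else []) xs) = map (\<lambda>p. (p, q)) (filter P xs)" for P xs
    by (induction xs) auto
  then show ?thesis unfolding sel_with_denom_def by simp
qed

lemma selected_Suc: "2 \<le> Q \<Longrightarrow> selected sel (Suc Q) = selected sel Q @ sel_with_denom sel Q"
  by (simp add: selected_def)

lemma set_selected: "set (selected sel Q) = {(p, q). 2 \<le> q \<and> q < Q \<and> 1 \<le> p \<and> p < q \<and> coprime p q \<and> sel p q}"
proof -
  have u: "set (selected sel Q) = (\<Union>q\<in>{2..<Q}. (\<lambda>p. (p, q)) ` {p \<in> {1..<q}. coprime p q \<and> sel p q})"
    by (simp add: selected_def sel_with_denom_eq)
  have m: "(a, b) \<in> (\<Union>q\<in>{2..<Q}. (\<lambda>p. (p, q)) ` S q) \<longleftrightarrow> b \<in> {2..<Q} \<and> a \<in> S b"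
    for a b :: nat and S by blast
  have "(a, b) \<in> set (selected sel Q) \<longleftrightarrow>
      2 \<le> b \<and> b < Q \<and> 1 \<le> a \<and> a < b \<and> coprime a b \<and> sel a b" for a b
    unfolding u m by simp
  then show ?thesis by (simp add: set_eq_iff)
qed

lemma distinct_selected: "distinct (selected sel Q)"
proof (induction Q)
  case 0
  show ?case by (simp add: selected_def)
next
  case (Suc Q)
  show ?case
  proof (cases "2 \<le> Q")
    case True
    have "set (selected sel Q) \<inter> set (sel_with_denom sel Q) = {}"
      by (auto simp: set_selected sel_with_denom_eq)
    moreover have "distinct (sel_with_denom sel Q)"
      by (auto simp: sel_with_denom_eq distinct_map inj_on_def)
    ultimately show ?thesis using Suc True by (simp add: selected_Suc)
  qed (simp add: selected_def)
qed

lemma concat_word_mono: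
  assumes "Q \<le> Q'"
  shows "\<exists>v. concat_word sel Q' = concat_word sel Q @ v"
  using assms
proof (induction rule: dec_induct)
  case (step n)
  then obtain v where v: "concat_word sel n = concat_word sel Q @ v" by blast
  have "\<exists>v'. concat_word sel (Suc n) = concat_word sel n @ v'"
  proof (cases "2 \<le> n")
    case True
    then show ?thesis by (simp add: concat_word_eq selected_Suc)
  next
    case False
    then show ?thesis by (simp add: concat_word_eq selected_def)
  qed
  with v show ?case by auto
qed simp

lemma length_cf_long_pos: "0 < length (cf_long p q)"
  by (simp add: cf_long_def Let_def)

text \<open>Distinct primes are coprime, so each pair p < q is selected, and each selected fraction
  contributes at least one digit.\<close>

lemma length_concat_word_ge:
  assumes sel: "\<And>p q. prime p \<Longrightarrow> prime q \<Longrightarrow> sel p q"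
  shows "card {(p, q). prime p \<and> prime q \<and> p < q \<and> q < Q} \<le> length (concat_word sel Q)"
proof -
  have "{(p, q). prime p \<and> prime q \<and> p < q \<and> q < Q} \<subseteq> set (selected sel Q)"
    unfolding set_selected using sel
    by (auto simp: prime_ge_2_nat primes_coprime prime_gt_0_nat Suc_leI)
  then have "card {(p, q). prime p \<and> prime q \<and> p < q \<and> q < Q} \<le> card (set (selected sel Q))"
    by (intro card_mono) auto
  also have "\<dots> \<le> length (selected sel Q)" by (rule card_length)
  also have "\<dots> \<le> length (concat_word sel Q)"
  proof -
    have "length xs \<le> length (concat (map cf_word xs))" for xs
    proof (induction xs)
      case (Cons z xs)
      obtain p q where "z = (p, q)" by fastforce
      then have "length (concat (map cf_word (z # xs))) = length (cf_long p q) + length (concat (map cf_word xs))"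
        by simp
      moreover have "length (z # xs) = Suc (length xs)" by simp
      ultimately show ?case using Cons.IH length_cf_long_pos[of p q] by linarith
    qed simp
    then show ?thesis by (simp add: concat_word_eq)
  qed
  finally show ?thesis .
qed

text \<open>This is g (g - 1) / 2, where g is Chebyshev's lower bound for the number of primes below
  Q; it is of order Q^2 / (log Q)^2.\<close>

definition length_bound :: "nat \<Rightarrow> real" where
  "length_bound Q = (real Q - 2) * ln 2 / ln (real Q - 1) * ((real Q - 2) * ln 2 / ln (real Q - 1) - 1) / 2"

lemma length_concat_word_asymp:
  assumes sel: "\<And>p q. prime p \<Longrightarrow> prime q \<Longrightarrow> sel p q"
  shows "\<forall>\<^sub>F Q in sequentially. length_bound Q \<le> real (length (concat_word sel Q))"
proof -
  have "\<forall>\<^sub>F Q::nat in sequentially. 1 \<le> (real Q - 2) * ln 2 / ln (real Q - 1)" by real_asymp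
  then show ?thesis using eventually_ge_at_top[of 3]
  proof eventually_elim
    case (elim Q)
    define g where "g = (real Q - 2) * ln 2 / ln (real Q - 1)"
    define P where "P = card {p::nat. prime p \<and> p < Q}"
    define n where "n = Q - 2"
    have n: "Q = Suc (Suc n)" using elim(2) by (simp add: n_def)
    have eq: "{p::nat. prime p \<and> p < Q} = {p. prime p \<and> p \<le> Suc n}" by (auto simp: n)
    have ln: "0 < ln (real Q - 1)" using elim(2) by simp
    have "real n * ln 2 \<le> real P * ln (real (Suc n))"
      unfolding P_def eq by (rule chebyshev_lower_bound)
    then have gP: "g \<le> real P" unfolding g_def using ln by (simp add: n field_simps)
    \<comment> \<open>From 1 on, g (g - 1) increases with g, so the bound for primes passes to
      pairs.\<close>
    have g1: "1 \<le> g" using elim(1) by (simp add: g_def)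
    have "g * (g - 1) \<le> real P * (real P - 1)" using gP g1 by (intro mult_mono) auto
    also have "\<dots> = real (P * (P - 1))" using gP g1 by (cases P) (auto simp: algebra_simps)
    also have "\<dots> = real (card {(p, q). prime p \<and> prime q \<and> p < q \<and> q < Q} * 2)"
      unfolding P_def prime_pairs_count ..
    also have "\<dots> \<le> real (length (concat_word sel Q) * 2)"
      using length_concat_word_ge[of sel Q, OF sel] by (intro of_nat_mono mult_le_mono1)
    finally show ?case by (simp add: length_bound_def g_def[symmetric])
  qed
qed

section \<open>Frequency errors in prefixes\<close>

lemma take_concat:
  "\<exists>m v. take N (concat xss) = concat (take m xss) @ v \<and>
     (v = [] \<or> (m < length xss \<and> length v \<le> length (xss ! m)))"
proof (induction xss arbitrary: N)
  case (Cons xs xss)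
  show ?case
  proof (cases "N \<le> length xs")
    case True
    then show ?thesis by (intro exI[of _ 0] exI[of _ "take N xs"]) simp
  next
    case False
    obtain m v where "take (N - length xs) (concat xss) = concat (take m xss) @ v"
      "v = [] \<or> (m < length xss \<and> length v \<le> length (xss ! m))" using Cons by blast
    then show ?thesis using False by (intro exI[of _ "Suc m"] exI[of _ v]) simp
  qed
qed simp

lemma deviation_concat:
  assumes "s \<noteq> []"
  shows "\<bar>deviation s (concat ws)\<bar> \<le> (\<Sum>w\<leftarrow>ws. \<bar>deviation s w\<bar> + real (length s))"
proof (induction ws)
  case Nil
  show ?case using assms by (simp add: deviation_def occurrences_def)
next
  case (Cons w ws)
  then show ?case using deviation_append[OF assms, of w "concat ws"] by simp
qed

text \<open>There are three sources of error: a bad fraction costs at most its length plus a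
  junction, a good one a small multiple of its length, and the word cut off at \<open>N\<close> its
  length plus a junction. No fraction occurs twice, so the first kind is bounded by the number of
  all bad fractions up to Q.\<close>

lemma deviation_prefix:
  assumes s: "s \<noteq> []" "\<forall>k\<in>set s. 0 < k" and c: "0 < c" and \<epsilon>: "0 < \<epsilon>" and Q: "2 \<le> Q"
  shows "\<bar>deviation s (take N (concat_word sel (Suc Q)))\<bar>
     \<le> (2 * log 2 (real Q) + 1 + real (length s)) * real (card (bad_rationals s \<epsilon> c Q))
       + (\<epsilon> + real (length s) / (c * ln (real Q))) * real N
       + 2 * log 2 (real Q) + 1 + real (length s)"
proof -
  let ?l = "real (length s)" and ?bad = "bad_rationals s \<epsilon> c Q"
  define M where "M = 2 * log 2 (real Q) + 1"
  define \<kappa> where "\<kappa> = \<epsilon> + ?l / (c * ln (real Q))"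
  have lnQ: "0 < ln (real Q)" using Q by simp
  have M0: "0 \<le> M" using Q by (simp add: M_def)
  have \<kappa>0: "0 \<le> \<kappa>" using \<epsilon> c lnQ by (simp add: \<kappa>_def)
  have far: "set (selected sel (Suc Q)) \<subseteq> farey Q" by (auto simp: set_selected farey_def)
  obtain m v where mv: "take N (concat_word sel (Suc Q)) = concat (take m (map cf_word (selected sel (Suc Q)))) @ v"
    "v = [] \<or> (m < length (map cf_word (selected sel (Suc Q))) \<and> length v \<le> length (map cf_word (selected sel (Suc Q)) ! m))"
    using take_concat unfolding concat_word_eq by blast
  define xs where "xs = take m (selected sel (Suc Q))"
  have xs: "set xs \<subseteq> farey Q" "distinct xs"
    using far set_take_subset[of m] distinct_selected by (fastforce simp: xs_def)+
  have w: "take N (concat_word sel (Suc Q)) = concat (map cf_word xs) @ v"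
    using mv(1) by (simp add: xs_def take_map)
  have v: "real (length v) \<le> M"
    using mv(2)
  proof
    assume "v = []"
    then show ?thesis using M0 by simp
  next
    assume a: "m < length (map cf_word (selected sel (Suc Q))) \<and> length v \<le> length (map cf_word (selected sel (Suc Q)) ! m)"
    then have "selected sel (Suc Q) ! m \<in> farey Q" using far nth_mem by fastforce
    then have "real (length (cf_word (selected sel (Suc Q) ! m))) \<le> M"
      unfolding M_def by (rule length_cf_word_le)
    moreover have "length v \<le> length (cf_word (selected sel (Suc Q) ! m))"
      using conjunct1[OF a] conjunct2[OF a] by simp
    ultimately show ?thesis by linarith
  qed
  have len: "real (length (concat (map cf_word xs))) \<le> real N"
  proof -
    have "length (concat (map cf_word xs)) \<le> length (take N (concat_word sel (Suc Q)))" unfolding w by simp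
    then show ?thesis by simp
  qed
  have one: "\<bar>deviation s (cf_word z)\<bar> + ?l
      \<le> (M + ?l) * indicator ?bad z + \<kappa> * real (length (cf_word z))" if z: "z \<in> farey Q" for z
  proof (cases "z \<in> ?bad")
    case True
    have "\<bar>deviation s (cf_word z)\<bar> \<le> M"
      using deviation_le[OF s, of "cf_word z"] length_cf_word_le[OF z] unfolding M_def by linarith
    moreover have "0 \<le> \<kappa> * real (length (cf_word z))" using \<kappa>0 by simp
    ultimately show ?thesis using True by simp
  next
    case False
    then have g: "c * ln (real Q) \<le> real (length (cf_word z))"
      "\<bar>deviation s (cf_word z)\<bar> \<le> \<epsilon> * real (length (cf_word z))"
      using z unfolding bad_rationals_def by (auto simp: not_less)
    \<comment> \<open>A good word has at least c ln Q digits, so its junction is charged to these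
      digits at the rate \<open>length s\<close> / (c ln Q).\<close>
    have "?l = ?l / (c * ln (real Q)) * (c * ln (real Q))" using c lnQ by simp
    also have "\<dots> \<le> ?l / (c * ln (real Q)) * real (length (cf_word z))"
      using g(1) c lnQ by (intro mult_left_mono) auto
    finally show ?thesis using g(2) False by (simp add: \<kappa>_def distrib_right)
  qed
  have "\<bar>deviation s (concat (map cf_word xs))\<bar> \<le> (\<Sum>z\<leftarrow>xs. \<bar>deviation s (cf_word z)\<bar> + ?l)"
    using deviation_concat[OF s(1), of "map cf_word xs"] by (simp add: comp_def)
  also have "\<dots> \<le> (\<Sum>z\<leftarrow>xs. (M + ?l) * indicator ?bad z + \<kappa> * real (length (cf_word z)))"
    using xs(1) by (intro sum_list_mono one) auto
  also have "\<dots> = (M + ?l) * (\<Sum>z\<leftarrow>xs. indicator ?bad z) + \<kappa> * (\<Sum>z\<leftarrow>xs. real (length (cf_word z)))"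
    by (simp add: sum_list_addf sum_list_const_mult)
  also have "(\<Sum>z\<leftarrow>xs. indicator ?bad z) = real (card (?bad \<inter> set xs))"
    using xs(2) by (simp add: sum_list_distinct_conv_sum_set indicator_def sum_of_bool_eq Int_commute)
  also have "(\<Sum>z\<leftarrow>xs. real (length (cf_word z))) = real (length (concat (map cf_word xs)))"
    by (simp add: length_concat comp_def sum_list_of_nat[symmetric] del: length_concat_rev)
  also have "(M + ?l) * real (card (?bad \<inter> set xs)) + \<kappa> * real (length (concat (map cf_word xs)))
      \<le> (M + ?l) * real (card ?bad) + \<kappa> * real N"
  proof (intro add_mono mult_left_mono len \<kappa>0)
    have "finite ?bad" by (rule finite_subset[OF _ finite_farey[of Q]]) (auto simp: bad_rationals_def)
    then show "real (card (?bad \<inter> set xs)) \<le> real (card ?bad)" by (intro of_nat_mono card_mono) auto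
  qed (use M0 in auto)
  finally have 1: "\<bar>deviation s (concat (map cf_word xs))\<bar> \<le> (M + ?l) * real (card ?bad) + \<kappa> * real N" .
  have 2: "\<bar>deviation s v\<bar> \<le> M" using deviation_le[OF s, of v] v by linarith
  have "\<bar>deviation s (take N (concat_word sel (Suc Q)))\<bar> \<le> (M + ?l) * real (card ?bad) + \<kappa> * real N + M + ?l"
    unfolding w using 1 2 deviation_append[OF s(1), of "concat (map cf_word xs)" v] by linarith
  then show ?thesis by (simp add: M_def \<kappa>_def add_ac)
qed

text \<open>\<open>occ_count\<close> numbers positions from 1 and admits occurrences that start by
  position N and end beyond it; only the last \<open>length s\<close> starts can make a
  difference.\<close>

lemma occ_count_occurrences:
  assumes w: "length w = N" "\<And>i. i < N \<Longrightarrow> cf_digit x (i + 1) = w ! i" and s: "s \<noteq> []"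
  shows "\<bar>real (occ_count s N x) - real (occurrences s w)\<bar> \<le> real (length s)"
proof -
  define A where "A = {i \<in> {1..N}. \<forall>j < length s. cf_digit x (i + j) = s ! j}"
  define P where "P = {i. i + length s \<le> length w \<and> take (length s) (drop i w) = s}"
  have finA: "finite A" by (simp add: A_def)
  have finP: "finite P" unfolding P_def by (rule finite_occurrences)
  have iff: "Suc i \<in> A \<longleftrightarrow> i \<in> P" if "i + length s \<le> N" for i
  proof -
    have "0 < length s" using s by simp
    then have "Suc i \<in> A \<longleftrightarrow> (\<forall>j<length s. cf_digit x (Suc i + j) = s ! j)"
      using that by (auto simp: A_def simp del: length_greater_0_conv)
    also have "\<dots> \<longleftrightarrow> (\<forall>j<length s. w ! (i + j) = s ! j)"
    proof -
      have "cf_digit x (Suc i + j) = w ! (i + j)" if "j < length s" for j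
        using w(2)[of "i + j"] that \<open>i + length s \<le> N\<close> by simp
      then show ?thesis by simp
    qed
    also have "\<dots> \<longleftrightarrow> take (length s) (drop i w) = s"
      using that w(1) by (auto simp: list_eq_iff_nth_eq)
    finally show ?thesis using that w(1) by (simp add: P_def)
  qed
  have cP: "card (Suc ` P) = card P" by (rule card_image) simp
  have "Suc ` P \<subseteq> A" using iff w(1) by (auto simp: P_def)
  then have 1: "card P \<le> card A" using card_mono[OF finA] cP by metis
  have "A \<subseteq> Suc ` P \<union> {Suc (N - length s)..N}"
  proof
    fix i assume i: "i \<in> A"
    then obtain k where k: "i = Suc k" by (cases i) (auto simp: A_def)
    show "i \<in> Suc ` P \<union> {Suc (N - length s)..N}"
    proof (cases "k + length s \<le> N")
      case True
      then show ?thesis using iff i k by auto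
    next
      case False
      then show ?thesis using i k by (auto simp: A_def)
    qed
  qed
  then have "card A \<le> card (Suc ` P \<union> {Suc (N - length s)..N})" using finP by (intro card_mono) auto
  also have "\<dots> \<le> card (Suc ` P) + card {Suc (N - length s)..N}" by (rule card_Un_le)
  also have "\<dots> \<le> card P + length s" using cP by simp
  finally have 2: "card A \<le> card P + length s" .
  have "occ_count s N x = card A" "occurrences s w = card P"
    by (simp_all add: occ_count_def occurrences_def A_def P_def)
  with 1 2 show ?thesis by linarith
qed

lemma set_concat_word_pos: "k \<in> set (concat_word sel Q) \<Longrightarrow> 0 < k"
proof -
  assume "k \<in> set (concat_word sel Q)"
  then obtain z where z: "z \<in> set (selected sel Q)" "k \<in> set (cf_word z)"
    unfolding concat_word_eq by (auto simp del: split_paired_Ex)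
  then have "z \<in> farey Q" by (auto simp: set_selected farey_def)
  from cf_word_farey(1)[OF this] z(2) show ?thesis by blast
qed

lemma concat_word_nth:
  assumes "i < length (concat_word sel Q)" "i < length (concat_word sel Q')"
  shows "concat_word sel Q ! i = concat_word sel Q' ! i"
proof -
  have "concat_word sel Q ! i = concat_word sel Q' ! i"
    if "Q \<le> Q'" "i < length (concat_word sel Q)" for Q Q'
    using concat_word_mono[OF that(1), of sel] that(2) by (auto simp: nth_append)
  then show ?thesis using assms by (metis nle_le)
qed

theorem concat_word_normal:
  assumes sel: "\<And>p q. prime p \<Longrightarrow> prime q \<Longrightarrow> sel p q"
  shows "\<exists>x. 0 \<le> x \<and> x < 1 \<and>
           (\<forall>Q. \<forall>i < length (concat_word sel Q). cf_digit x (i + 1) = concat_word sel Q ! i) \<and>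
           CF_normal x"
proof -
  define len where "len Q = length (concat_word sel Q)" for Q
  have len_mono: "len Q \<le> len Q'" if "Q \<le> Q'" for Q Q'
    using concat_word_mono[OF that, of sel] by (auto simp: len_def)
  have lb_top: "filterlim length_bound at_top sequentially" unfolding length_bound_def by real_asymp
  have asymp: "\<forall>\<^sub>F Q in sequentially. length_bound Q \<le> real (len Q)"
    unfolding len_def by (rule length_concat_word_asymp) (rule sel)
  have unb: "\<exists>Q. n < len Q" for n
  proof -
    have "\<forall>\<^sub>F Q in sequentially. real n < length_bound Q"
      using lb_top by (simp add: filterlim_at_top_dense)
    then have "\<forall>\<^sub>F Q in sequentially. real n < real (len Q)"
      using asymp by eventually_elim linarith
    then show ?thesis by (auto dest: eventually_happens)
  qed
  \<comment> \<open>The words \<open>concat_word sel Q\<close> are prefixes of one another, so any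
    of them that is long enough yields the digit.\<close>
  define a where "a i = concat_word sel (LEAST Q. i < len Q) ! i" for i
  have L: "i < len (LEAST Q. i < len Q)" for i using unb by (rule LeastI_ex)
  have a_eq: "concat_word sel Q ! i = a i" if "i < len Q" for Q i
    unfolding a_def using that L[of i] unfolding len_def by (rule concat_word_nth)
  have "0 < a i" for i
    using set_concat_word_pos[OF nth_mem[OF L[of i, unfolded len_def]]] unfolding a_def len_def .
  then obtain x where x: "0 \<le> x" "x < 1" "\<And>i. cf_digit x (i + 1) = a i"
    using cf_number_exists[of a] by blast
  have "(\<lambda>N. real (occ_count s N x) / real N) \<longlonglongrightarrow> gauss_measure (cylinder s)"
    if s: "s \<noteq> []" "\<forall>d\<in>set s. 0 < d" for s
  proof (rule tendstoI)
    fix e :: real assume e: "0 < e"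
    \<comment> \<open>\<open>card_bad_rationals\<close> asks for a value of at most 1; the other
      half of \<open>e\<close> is reserved for the remaining errors.\<close>
    define \<epsilon> where "\<epsilon> = min 1 (e / 2)"
    have \<epsilon>: "0 < \<epsilon>" "\<epsilon> \<le> 1" "\<epsilon> \<le> e / 2" using e by (auto simp: \<epsilon>_def)
    obtain c \<eta> where c: "0 < c" and \<eta>: "0 < \<eta>" "\<eta> < 1"
      and bad: "\<And>Q. 2 \<le> Q \<Longrightarrow> real (card (bad_rationals s \<epsilon> c Q))
         \<le> 12 * (2 * log 2 (real Q) + 2) * real Q powr (2 - \<eta>)"
      using card_bad_rationals[OF s \<epsilon>(1,2)] by blast
    define l where "l = real (length s)"
    \<comment> \<open>\<open>E\<close> collects the errors not proportional to N: bad fractions, the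
      cut word with its junction, and the passage from \<open>occurrences\<close> to
      \<open>occ_count\<close>, whence 2 l. It is of order Q^(2 - \<eta>) (log Q)^2 and so
      negligible against \<open>length_bound\<close>.\<close>
    define E where "E Q = (2 * log 2 (real Q) + 1 + l) * (12 * (2 * log 2 (real Q) + 2) * real Q powr (2 - \<eta>))
        + 2 * log 2 (real Q) + 1 + 2 * l" for Q :: nat
    have "(\<lambda>Q. E Q / length_bound Q + l / (c * ln (real Q))) \<longlonglongrightarrow> 0 + 0"
    proof (rule tendsto_add)
      show "(\<lambda>Q. E Q / length_bound Q) \<longlonglongrightarrow> 0"
        unfolding E_def length_bound_def using \<eta> by real_asymp
      show "(\<lambda>Q::nat. l / (c * ln (real Q))) \<longlonglongrightarrow> 0" using c by real_asymp
    qed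
    then have "\<forall>\<^sub>F Q in sequentially. E Q / length_bound Q + l / (c * ln (real Q)) < e / 2"
      using e by (intro order_tendstoD(2)) auto
    moreover have "\<forall>\<^sub>F Q in sequentially. 0 < length_bound Q"
      using lb_top by (simp add: filterlim_at_top_dense)
    ultimately have "\<forall>\<^sub>F Q in sequentially. 2 \<le> Q \<and> 0 < length_bound Q \<and> length_bound Q \<le> real (len Q) \<and>
        E Q / length_bound Q + l / (c * ln (real Q)) < e / 2"
      using asymp eventually_ge_at_top[of 2]
      by eventually_elim auto
    then obtain Q0 where Q0: "\<And>Q. Q0 \<le> Q \<Longrightarrow> 2 \<le> Q \<and> 0 < length_bound Q \<and> length_bound Q \<le> real (len Q) \<and>
        E Q / length_bound Q + l / (c * ln (real Q)) < e / 2"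
      unfolding eventually_sequentially by blast
    have "dist (real (occ_count s N x) / real N) (word_freq s) < e" if N: "len Q0 \<le> N" for N
    proof -
      \<comment> \<open>With Q' = Q + 1, position N falls among the fractions of denominator Q: len
        Q <= N < len (Q + 1). So the first N digits involve denominators up to Q only, while N is at
        least \<open>length_bound Q\<close>.\<close>
      define Q' where "Q' = (LEAST Q. N < len Q)"
      have Q': "N < len Q'" unfolding Q'_def by (rule L)
      have "Q0 < Q'" using len_mono[of Q' Q0] Q' N by (metis leD leI order.strict_trans2)
      then obtain Q where Q: "Q' = Suc Q" "Q0 \<le> Q" by (cases Q') auto
      have "\<not> N < len Q" using not_less_Least[of Q "\<lambda>Q. N < len Q"] Q(1) by (simp add: Q'_def)
      then have NQ: "len Q \<le> N" "N < len (Suc Q)" using Q' Q(1) by auto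
      have Q2: "2 \<le> Q" and lb: "0 < length_bound Q" "length_bound Q \<le> real N"
        and small: "E Q / length_bound Q + l / (c * ln (real Q)) < e / 2"
        using Q0[OF Q(2)] NQ(1) by auto
      define w where "w = take N (concat_word sel (Suc Q))"
      have w: "length w = N" using NQ(2) by (simp add: w_def len_def)
      have dig: "cf_digit x (i + 1) = w ! i" if "i < N" for i
        using that NQ(2) a_eq[of i "Suc Q"] by (simp add: w_def x(3)[simplified])
      have N0: "0 < real N" using lb by linarith
      have "\<bar>deviation s w\<bar> \<le> (2 * log 2 (real Q) + 1 + l) * real (card (bad_rationals s \<epsilon> c Q))
          + (\<epsilon> + l / (c * ln (real Q))) * real N + 2 * log 2 (real Q) + 1 + l"
        unfolding w_def l_def by (intro deviation_prefix s c \<epsilon> Q2)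
      moreover have "(2 * log 2 (real Q) + 1 + l) * real (card (bad_rationals s \<epsilon> c Q))
          \<le> (2 * log 2 (real Q) + 1 + l) * (12 * (2 * log 2 (real Q) + 2) * real Q powr (2 - \<eta>))"
        using Q2 by (intro mult_left_mono bad) (auto simp: l_def)
      moreover have "\<bar>real (occ_count s N x) - real (occurrences s w)\<bar> \<le> l"
        unfolding l_def using w dig s(1) by (rule occ_count_occurrences)
      moreover have "real (occ_count s N x) - word_freq s * real N
          = (real (occ_count s N x) - real (occurrences s w)) + deviation s w"
        by (simp add: deviation_def w)
      ultimately have "\<bar>real (occ_count s N x) - word_freq s * real N\<bar>
          \<le> E Q + (\<epsilon> + l / (c * ln (real Q))) * real N"
        unfolding E_def by linarith
      then have "\<bar>real (occ_count s N x) - word_freq s * real N\<bar> / real N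
          \<le> (E Q + (\<epsilon> + l / (c * ln (real Q))) * real N) / real N"
        using N0 by (intro divide_right_mono) auto
      also have "\<dots> = E Q / real N + \<epsilon> + l / (c * ln (real Q))"
        using N0 by (simp add: add_divide_distrib)
      also have "E Q / real N \<le> E Q / length_bound Q"
        using lb Q2 by (intro divide_left_mono) (auto simp: E_def l_def)
      also have "\<bar>real (occ_count s N x) - word_freq s * real N\<bar> / real N
          = \<bar>real (occ_count s N x) / real N - word_freq s\<bar>"
      proof -
        have "real (occ_count s N x) / real N - word_freq s
            = (real (occ_count s N x) - word_freq s * real N) / real N"
          using N0 by (simp add: field_simps)
        then show ?thesis by (simp add: abs_divide)
      qed
      finally show ?thesis using small \<epsilon>(3) unfolding dist_real_def by linarith
    qed
    then show "\<forall>\<^sub>F N in sequentially. dist (real (occ_count s N x) / real N) (gauss_measure (cylinder s)) < e"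
      unfolding eventually_sequentially gauss_measure_cylinder[OF s(2)] by blast
  qed
  then have "CF_normal x" unfolding CF_normal_def by blast
  moreover have "cf_digit x (i + 1) = concat_word sel Q ! i" if "i < length (concat_word sel Q)" for Q i
    using a_eq[of i Q] that x(3) by (simp add: len_def)
  ultimately show ?thesis using x(1,2) by blast
qed

text \<open>The expansion is given by its prefixes, whose lengths are unbounded, so that every digit
  of \<open>x\<close> is prescribed; each of the three selections admits all pairs of
  primes.\<close>

theorem theorem1p4:
  fixes sel :: "nat \<Rightarrow> nat \<Rightarrow> bool"
  assumes "sel = (\<lambda>p q. prime q) \<or> sel = (\<lambda>p q. prime p) \<or> sel = (\<lambda>p q. prime p \<and> prime q)"
  shows "\<exists>x. 0 \<le> x \<and> x < 1 \<and>
           (\<forall>Q. \<forall>i < length (concat_word sel Q). cf_digit x (i + 1) = concat_word sel Q ! i) \<and>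
           CF_normal x"
  using assms by (intro concat_word_normal) auto

end
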